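(* Fix $d\ge 3$, $c>0$, $\delta<1$, let $p=(c+o_n(1))n^{-d+1+\delta}$ and $\mathcal{H}$ the random $d$-uniform hypergraph on $[n]$ with each $d$-subset a hyperedge independently with probability $p$. If $\delta=\frac{2d-4}{2d-1}$ then the probability of exact recovery is $1-\Omega_n(1)$, and if $\delta>\frac{2d-4}{2d-1}$ then the probability of exact recovery is $o_n(1)$.
   Context: $\mathrm{Proj}(H)$ is the graph on $[n]$ with $\{i,j\}$ an edge iff some hyperedge of $H$ contains $\{i,j\}$. The probability of exact recovery is the maximum over all functions $\mathcal{A}$ from projected graphs to $d$-uniform hypergraphs on $[n]$ of $\Pr[\mathcal{A}(\mathrm{Proj}(\mathcal{H}))=\mathcal{H}]$ (attained by the MAP estimator). *)

theory Defs
  imports "HOL-Probability.Probability" "HOL-Library.Ramsey"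
    "HOL-Library.Landau_Symbols"
begin

text \<open>
  The vertex set is always \<open>[n] = {1..n}\<close>, so graphs and hypergraphs on it are represented by
  their sets of (hyper)edges; \<open>nsets {1..n} k\<close> is the set of \<open>k\<close>-subsets of \<open>[n]\<close>.
\<close>

definition uniform_hypergraphs :: "nat \<Rightarrow> nat \<Rightarrow> nat set set set" where
  "uniform_hypergraphs d n = Pow (nsets {1..n} d)"

definition Proj :: "nat \<Rightarrow> nat set set \<Rightarrow> nat set set" where
  "Proj n H = {{i, j} | i j. i \<in> {1..n} \<and> j \<in> {1..n} \<and> i \<noteq> j \<and> (\<exists>h\<in>H. {i, j} \<subseteq> h)}"

text \<open>
  \<^const>\<open>bernoulli_pmf\<close> truncates its parameter to \<open>[0, 1]\<close>, so this is a probability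
  distribution for every real \<open>p\<close>.
\<close>

definition random_hypergraph :: "nat \<Rightarrow> nat \<Rightarrow> real \<Rightarrow> nat set set pmf" where
  "random_hypergraph d n p =
     map_pmf (\<lambda>f. {h \<in> nsets {1..n} d. f h})
       (Pi_pmf (nsets {1..n} d) False (\<lambda>_. bernoulli_pmf p))"

text \<open>
  Estimators are functions from projected graphs to \<open>d\<close>-uniform hypergraphs on \<open>[n]\<close>. Taking them
  extensional (fixing their irrelevant values elsewhere) makes the set of estimators finite.
\<close>

definition estimators :: "nat \<Rightarrow> nat \<Rightarrow> (nat set set \<Rightarrow> nat set set) set" where
  "estimators d n = Proj n ` uniform_hypergraphs d n \<rightarrow>\<^sub>E uniform_hypergraphs d n"

definition exact_recovery_prob :: "nat \<Rightarrow> nat \<Rightarrow> real \<Rightarrow> real" where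
  "exact_recovery_prob d n p =
     (MAX A \<in> estimators d n.
        measure_pmf.prob (random_hypergraph d n p) {H. A (Proj n H) = H})"

lemma finite_uniform_hypergraphs: "finite (uniform_hypergraphs d n)"
  by (simp add: uniform_hypergraphs_def finite_imp_finite_nsets)

lemma finite_estimators: "finite (estimators d n)"
  by (simp add: estimators_def finite_PiE finite_uniform_hypergraphs)

lemma estimators_nonempty: "estimators d n \<noteq> {}"
  by (auto simp: estimators_def uniform_hypergraphs_def PiE_eq_empty_iff)

lemma set_pmf_random_hypergraph:
  "set_pmf (random_hypergraph d n p) \<subseteq> uniform_hypergraphs d n"
  by (auto simp: random_hypergraph_def uniform_hypergraphs_def)

end

theory Submission
  imports Defs
begin

text \<open>
  Let \<open>S\<close> be a set of \<open>d - 1\<close> vertices and let \<open>a\<close>, \<open>b\<close> be two further vertices such that \<open>S \<union> {a}\<close> is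
  a hyperedge, \<open>S \<union> {b}\<close> is not, and all pairs \<open>{a, s}\<close>, \<open>{b, s}\<close> with \<open>s \<in> S\<close> are covered by other
  hyperedges. Replacing \<open>S \<union> {a}\<close> by \<open>S \<union> {b}\<close> preserves the projection and the probability of the
  hypergraph. Such a swap involves \<open>2 d - 1\<close> hyperedges on \<open>2 d\<^sup>2 - 5 d + 5\<close> vertices, so the expected
  number of swaps has order \<open>n\<close> to the power \<open>(2 d - 1) \<delta> - (2 d - 4)\<close>.

  If \<open>N\<close> is the number of swaps available in the random hypergraph, an estimator succeeds with
  probability at most \<open>E (1 / (1 + N))\<close>, so by Cauchy-Schwarz it fails with probability at least
  \<open>E (N / (1 + N)) \<ge> (E N)\<^sup>2 / (E N + E N\<^sup>2)\<close>. The second moment is tractable when \<open>a\<close>, \<open>b\<close>, the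
  elements of \<open>S\<close>, and the remaining vertices of the covering hyperedges are taken from disjoint
  blocks of vertices, as the relevant events are then independent; it is
  \<open>(1 + o(1)) (E N)\<^sup>2 + O(E N)\<close>.
\<close>


subsection \<open>Ambiguity and exact recovery\<close>

text \<open>Hitting a block depends only on the coordinates in it. By induction,
  \<open>Pi_pmf_union\<close> splits off one block as an independent factor, and this block is
  missed with probability \<open>(1 - p) ^ card (K j)\<close>.\<close>

lemma prob_blocks_hit:
  fixes K :: "'j \<Rightarrow> 'a set"
  assumes "finite J" and "\<And>j. j \<in> J \<Longrightarrow> finite (K j)" and "disjoint_family_on K J"
    and p: "p \<in> {0..1}"
  shows "measure_pmf.prob (Pi_pmf (\<Union>j\<in>J. K j) False (\<lambda>_. bernoulli_pmf p))
           {f. \<forall>j\<in>J. \<exists>x\<in>K j. f x} = (\<Prod>j\<in>J. 1 - (1 - p) ^ card (K j))"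
  using assms(1,2,3)
proof (induction J rule: finite_induct)
  case empty
  then show ?case by simp
next
  case (insert j J)
  let ?A = "K j" and ?B = "\<Union>i\<in>J. K i"
  let ?P = "\<lambda>A. Pi_pmf A False (\<lambda>_. bernoulli_pmf p)"
  have fA: "finite ?A" and fB: "finite ?B" using insert by auto
  have disj: "?A \<inter> ?B = {}"
    using insert.prems(2) insert.hyps(2) unfolding disjoint_family_on_def by fastforce
  have "measure_pmf.prob (?P ?A) {f. \<forall>x\<in>?A. \<not> f x} = (1 - p) ^ card ?A"
  proof -
    have "{f. \<forall>x\<in>?A. \<not> f x} = Pi ?A (\<lambda>_. {False})" by (auto simp: Pi_def)
    then show ?thesis
      using p fA by (simp add: measure_Pi_pmf_Pi measure_pmf_single)
  qed
  moreover have "{f. \<exists>x\<in>?A. f x} = UNIV - {f. \<forall>x\<in>?A. \<not> f x}" by auto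
  ultimately have A: "measure_pmf.prob (?P ?A) {f. \<exists>x\<in>?A. f x} = 1 - (1 - p) ^ card ?A"
    by (simp add: measure_pmf.prob_compl[simplified])
  have supp: "f x = False" if "f \<in> set_pmf (?P A)" "x \<notin> A" "finite A" for f x and A :: "'a set"
    using that set_Pi_pmf_subset[of A False "\<lambda>_. bernoulli_pmf p"] by blast
  \<comment> \<open>Cutting the events down to the supports makes them countable, as the product
    rule for \<open>pair_pmf\<close> requires, and leaves their probabilities unchanged.\<close>
  define SA where "SA = {f. \<exists>x\<in>?A. f x} \<inter> set_pmf (?P ?A)"
  define SB where "SB = {f. \<forall>i\<in>J. \<exists>x\<in>K i. f x} \<inter> set_pmf (?P ?B)"
  have "measure_pmf.prob (?P (\<Union>i\<in>insert j J. K i)) {f. \<forall>i\<in>insert j J. \<exists>x\<in>K i. f x}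
      = measure_pmf.prob (pair_pmf (?P ?A) (?P ?B))
          ((\<lambda>(f, g) x. if x \<in> ?A then f x else g x) -` {f. \<forall>i\<in>insert j J. \<exists>x\<in>K i. f x})"
    using Pi_pmf_union[OF fA fB disj, of False "\<lambda>_. bernoulli_pmf p"] by simp
  also have "\<dots> = measure_pmf.prob (pair_pmf (?P ?A) (?P ?B)) (SA \<times> SB)"
  proof (rule measure_eq_AE)
    have "K i \<inter> ?A = {}" if "i \<in> J" for i using that disj by blast
    then show "AE h in measure_pmf (pair_pmf (?P ?A) (?P ?B)).
        (h \<in> (\<lambda>(f, g) x. if x \<in> ?A then f x else g x) -` {f. \<forall>i\<in>insert j J. \<exists>x\<in>K i. f x})
          = (h \<in> SA \<times> SB)"
      unfolding SA_def SB_def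
      by (intro AE_pmfI) (auto split: if_splits; (metis disjoint_iff)?)
  qed simp_all
  also have "\<dots> = measure_pmf.prob (?P ?A) SA * measure_pmf.prob (?P ?B) SB"
  proof (rule measure_pmf_prob_product)
    show "countable SA" unfolding SA_def by (rule countable_Int2) simp
    show "countable SB" unfolding SB_def by (rule countable_Int2) simp
  qed
  also have "\<dots> = (1 - (1 - p) ^ card ?A) * (\<Prod>i\<in>J. 1 - (1 - p) ^ card (K i))"
  proof -
    have "disjoint_family_on K J"
      using insert.prems(2) by (auto simp: disjoint_family_on_def)
    then show ?thesis
      unfolding SA_def SB_def measure_Int_set_pmf using A insert by simp
  qed
  finally show ?case using insert.hyps by simp
qed

text \<open>The mass depends on \<open>H\<close> only through \<open>card H\<close>, so exchanging
  one hyperedge for another preserves it. The values of \<open>pmf (bernoulli_pmf p)\<close> stand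
  in for \<open>p\<close> and \<open>1 - p\<close> because \<open>p\<close> may lie outside the unit
  interval.\<close>

lemma pmf_random_hypergraph:
  assumes "H \<in> uniform_hypergraphs d n"
  shows "pmf (random_hypergraph d n p) H =
    pmf (bernoulli_pmf p) True ^ card H *
    pmf (bernoulli_pmf p) False ^ (card (nsets {1..n} d) - card H)"
proof -
  let ?I = "nsets {1..n} d"
  let ?P = "Pi_pmf ?I False (\<lambda>_. bernoulli_pmf p)"
  have fI: "finite ?I" by (simp add: finite_imp_finite_nsets)
  have HI: "H \<subseteq> ?I" using assms by (simp add: uniform_hypergraphs_def)
  have "pmf (random_hypergraph d n p) H = measure_pmf.prob ?P ((\<lambda>f. {h \<in> ?I. f h}) -` {H})"
    unfolding random_hypergraph_def by (rule pmf_map)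
  \<comment> \<open>Functions that are true somewhere outside \<open>?I\<close> can map to
    \<open>H\<close> too, but the default value \<open>False\<close> gives them probability
    0.\<close>
  also have "\<dots> = measure_pmf.prob ?P {\<lambda>h. h \<in> H}"
  proof (rule measure_eq_AE)
    show "AE f in measure_pmf ?P. (f \<in> (\<lambda>f. {h \<in> ?I. f h}) -` {H}) = (f \<in> {\<lambda>h. h \<in> H})"
    proof (intro AE_pmfI)
      fix f assume "f \<in> set_pmf ?P"
      then have "\<forall>x. x \<notin> ?I \<longrightarrow> \<not> f x"
        using set_Pi_pmf_subset[OF fI, of False "\<lambda>_. bernoulli_pmf p"] by auto
      then show "(f \<in> (\<lambda>f. {h \<in> ?I. f h}) -` {H}) = (f \<in> {\<lambda>h. h \<in> H})"
        using HI by (auto simp: fun_eq_iff)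
    qed
  qed simp_all
  also have "\<dots> = pmf ?P (\<lambda>h. h \<in> H)" by (simp add: measure_pmf_single)
  also have "\<dots> = (\<Prod>h\<in>?I. pmf (bernoulli_pmf p) (h \<in> H))"
    using HI fI by (intro pmf_Pi') auto
  also have "\<dots> = (\<Prod>h\<in>H. pmf (bernoulli_pmf p) (h \<in> H)) *
      (\<Prod>h\<in>?I - H. pmf (bernoulli_pmf p) (h \<in> H))"
    by (subst prod.subset_diff[OF HI fI]) (rule mult.commute)
  also have "\<dots> = pmf (bernoulli_pmf p) True ^ card H * pmf (bernoulli_pmf p) False ^ card (?I - H)"
    by simp
  also have "card (?I - H) = card ?I - card H"
    using HI fI by (simp add: card_Diff_subset finite_subset)
  finally show ?thesis .
qed

text \<open>Equal projection and equal mass form an equivalence relation on the uniform hypergraphs;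
  these are its classes. The members of a class look the same to every estimator and are equally
  likely.\<close>

definition ambiguity_class :: "nat \<Rightarrow> nat \<Rightarrow> real \<Rightarrow> nat set set \<Rightarrow> nat set set set" where
  "ambiguity_class d n p H = {H' \<in> uniform_hypergraphs d n.
     Proj n H' = Proj n H \<and> pmf (random_hypergraph d n p) H' = pmf (random_hypergraph d n p) H}"

text \<open>An estimator is right on at most one member of each class, since all members have the
  same projection. The mass of that member is the sum, over its class, of mass divided by class
  size.\<close>

lemma exact_recovery_prob_le:
  "exact_recovery_prob d n p \<le>
    (\<Sum>H\<in>uniform_hypergraphs d n. pmf (random_hypergraph d n p) H / card (ambiguity_class d n p H))"
proof -
  let ?U = "uniform_hypergraphs d n" and ?P = "random_hypergraph d n p"
  let ?c = "ambiguity_class d n p"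
  have fin_c: "finite (?c H)" for H
    by (simp add: ambiguity_class_def finite_uniform_hypergraphs)
  have "measure_pmf.prob ?P {H. A (Proj n H) = H} \<le> (\<Sum>H\<in>?U. pmf ?P H / card (?c H))"
    if "A \<in> estimators d n" for A
  proof -
    define F where "F = {H \<in> ?U. A (Proj n H) = H}"
    have fF: "finite F" by (simp add: F_def finite_uniform_hypergraphs)
    have "measure_pmf.prob ?P {H. A (Proj n H) = H} = measure_pmf.prob ?P F"
      using set_pmf_random_hypergraph[of d n p]
      by (intro measure_eq_AE AE_pmfI) (auto simp: F_def)
    also have "\<dots> = (\<Sum>H\<in>F. pmf ?P H)"
      using fF by (rule measure_measure_pmf_finite)
    also have "\<dots> = (\<Sum>H\<in>F. \<Sum>H'\<in>?c H. pmf ?P H' / card (?c H'))"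
    proof (rule sum.cong)
      fix H assume "H \<in> F"
      then have "H \<in> ?c H" by (auto simp: F_def ambiguity_class_def)
      then have "card (?c H) \<noteq> 0" using fin_c by auto
      moreover have "pmf ?P H' / card (?c H') = pmf ?P H / card (?c H)" if "H' \<in> ?c H" for H'
      proof -
        have "?c H' = ?c H" using that by (auto simp: ambiguity_class_def)
        then show ?thesis using that by (simp add: ambiguity_class_def)
      qed
      ultimately show "pmf ?P H = (\<Sum>H'\<in>?c H. pmf ?P H' / card (?c H'))" by simp
    qed simp
    also have "\<dots> = (\<Sum>H\<in>(\<Union>H\<in>F. ?c H). pmf ?P H / card (?c H))"
    proof (rule sum.UNION_disjoint[symmetric])
      \<comment> \<open>If the classes of two successes met, their projections would agree, hence
        the answers of \<open>A\<close>, which are the successes themselves.\<close>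
      show "\<forall>H\<in>F. \<forall>H'\<in>F. H \<noteq> H' \<longrightarrow> ?c H \<inter> ?c H' = {}"
        by (auto simp: F_def ambiguity_class_def)
    qed (use fF fin_c in auto)
    also have "\<dots> \<le> (\<Sum>H\<in>?U. pmf ?P H / card (?c H))"
      by (rule sum_mono2) (auto simp: finite_uniform_hypergraphs ambiguity_class_def)
    finally show ?thesis .
  qed
  then show ?thesis
    unfolding exact_recovery_prob_def
    by (subst Max_le_iff) (auto simp: finite_estimators estimators_nonempty)
qed

text \<open>\<open>s1\<close> and \<open>s2\<close> are the first two moments of the number
  \<open>N\<close> of events \<open>Z t\<close> that occur. In place of Cauchy-Schwarz,
  \<open>1 / (1 + N)\<close> is bounded by a quadratic in \<open>N\<close> with a free parameter
  \<open>l\<close>; the difference times \<open>1 + N\<close> is \<open>N (1 - l (1 + N))^2\<close>.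
  Taking expectations leaves only the two moments.\<close>

lemma recovery_failure_second_moment:
  fixes d n :: nat and p :: real and T :: "'t set" and Z :: "'t \<Rightarrow> nat set set \<Rightarrow> bool"
  defines "P \<equiv> random_hypergraph d n p"
  defines "s1 \<equiv> (\<Sum>t\<in>T. measure_pmf.prob P {H. Z t H})"
    and "s2 \<equiv> (\<Sum>t\<in>T. \<Sum>t'\<in>T. measure_pmf.prob P {H. Z t H \<and> Z t' H})"
  assumes "finite T" and "s1 > 0"
    and N: "\<And>H. H \<in> uniform_hypergraphs d n \<Longrightarrow> card {t \<in> T. Z t H} < card (ambiguity_class d n p H)"
  shows "s1\<^sup>2 / (s1 + s2) \<le> 1 - exact_recovery_prob d n p"
proof -
  let ?U = "uniform_hypergraphs d n"
  define N where "N H = real (card {t \<in> T. Z t H})" for H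
  \<comment> \<open>This value minimises \<open>1 - 2 * l * s1 + l^2 * (s1 + s2)\<close>, the
    expectation of the quadratic bound.\<close>
  define l where "l = s1 / (s1 + s2)"
  have fU: "finite ?U" by (rule finite_uniform_hypergraphs)
  have prob: "measure_pmf.prob P {H. Q H} = (\<Sum>H\<in>?U. pmf P H * of_bool (Q H))" for Q
  proof -
    have "measure_pmf.prob P {H. Q H} = measure_pmf.prob P {H \<in> ?U. Q H}"
      using set_pmf_random_hypergraph[of d n p]
      by (intro measure_eq_AE AE_pmfI) (auto simp: P_def)
    also have "\<dots> = (\<Sum>H\<in>{H \<in> ?U. Q H}. pmf P H)"
      using fU by (intro measure_measure_pmf_finite) simp
    also have "\<dots> = (\<Sum>H\<in>?U. pmf P H * of_bool (Q H))"
      using fU by (simp add: sum.inter_filter of_bool_def if_distrib cong: if_cong)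
    finally show ?thesis .
  qed
  have N_sum: "N H = (\<Sum>t\<in>T. of_bool (Z t H))" for H
    using \<open>finite T\<close> by (simp add: N_def of_bool_def sum.If_cases Int_def)
  have s1: "s1 = (\<Sum>H\<in>?U. pmf P H * N H)"
    unfolding s1_def prob N_sum by (subst sum.swap) (simp add: sum_distrib_left)
  have "s2 = (\<Sum>t\<in>T. \<Sum>H\<in>?U. \<Sum>t'\<in>T. pmf P H * (of_bool (Z t H) * of_bool (Z t' H)))"
    unfolding s2_def prob of_bool_conj by (intro sum.cong sum.swap refl)
  also have "\<dots> = (\<Sum>H\<in>?U. pmf P H * (N H)\<^sup>2)"
    unfolding N_sum power2_eq_square sum_product
    by (subst sum.swap) (simp add: sum_distrib_left)
  finally have s2: "s2 = (\<Sum>H\<in>?U. pmf P H * (N H)\<^sup>2)" .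
  have "s2 \<ge> 0" unfolding s2_def by (simp add: sum_nonneg)
  have total: "(\<Sum>H\<in>?U. pmf P H) = 1"
    using prob[of "\<lambda>_. True"] by simp
  have "exact_recovery_prob d n p \<le> (\<Sum>H\<in>?U. pmf P H * (1 - 2 * l * N H + l\<^sup>2 * (N H + (N H)\<^sup>2)))"
  proof (rule order_trans[OF exact_recovery_prob_le sum_mono])
    fix H assume H: "H \<in> ?U"
    have N0: "N H \<ge> 0" by (simp add: N_def)
    have "real (card (ambiguity_class d n p H)) \<ge> 1 + N H"
      using N[OF H] by (simp add: N_def)
    then have "1 / card (ambiguity_class d n p H) \<le> 1 / (1 + N H)"
      using N0 by (intro divide_left_mono) auto
    also have "\<dots> \<le> 1 - 2 * l * N H + l\<^sup>2 * (N H + (N H)\<^sup>2)"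
    proof -
      have "(1 - 2 * l * N H + l\<^sup>2 * (N H + (N H)\<^sup>2)) * (1 + N H) - 1 = N H * (1 - l * (1 + N H))\<^sup>2"
        by (simp add: power2_eq_square algebra_simps)
      also have "\<dots> \<ge> 0" using N0 by simp
      finally show ?thesis using N0 by (simp add: divide_simps)
    qed
    finally show "pmf (random_hypergraph d n p) H / card (ambiguity_class d n p H)
        \<le> pmf P H * (1 - 2 * l * N H + l\<^sup>2 * (N H + (N H)\<^sup>2))"
      unfolding P_def[symmetric] using mult_left_mono[OF _ pmf_nonneg[of P H]] by fastforce
  qed
  also have "\<dots> = (\<Sum>H\<in>?U. pmf P H - 2 * l * (pmf P H * N H)
      + l\<^sup>2 * (pmf P H * N H + pmf P H * (N H)\<^sup>2))"
    by (intro sum.cong refl) (simp add: algebra_simps)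
  also have "\<dots> = 1 - 2 * l * s1 + l\<^sup>2 * (s1 + s2)"
    unfolding s1 s2 total[symmetric]
    by (simp add: sum.distrib sum_subtractf flip: sum_distrib_left)
  also have "\<dots> = 1 - s1\<^sup>2 / (s1 + s2)"
  proof -
    have "l * (s1 + s2) = s1" using \<open>s1 > 0\<close> \<open>s2 \<ge> 0\<close> by (simp add: l_def)
    then have "l\<^sup>2 * (s1 + s2) = l * s1" by (simp add: power2_eq_square)
    then show ?thesis by (simp add: l_def power2_eq_square)
  qed
  finally show ?thesis by simp
qed


subsection \<open>Traces outside a set of vertices\<close>

text \<open>A \<open>d\<close>-set with trace \<open>e\<close> is \<open>e\<close> together with an
  arbitrary choice of \<open>d - card e\<close> vertices of \<open>C\<close>.\<close>

lemma card_fibre_Diff: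
  assumes "C \<subseteq> V" and "finite V" and "e \<subseteq> V - C" and "card e \<le> d"
  shows "card {h \<in> nsets V d. h - C = e} = card C choose (d - card e)"
proof -
  have fin: "finite C" "finite e" using assms by (meson finite_subset finite_Diff)+
  have "bij_betw (\<lambda>c. e \<union> c) (nsets C (d - card e)) {h \<in> nsets V d. h - C = e}"
  proof (rule bij_betwI[where g = "\<lambda>h. h \<inter> C"])
    show "(\<lambda>c. e \<union> c) \<in> nsets C (d - card e) \<rightarrow> {h \<in> nsets V d. h - C = e}"
    proof
      fix c assume c: "c \<in> nsets C (d - card e)"
      then have "e \<inter> c = {}" using assms(3) by (auto simp: nsets_def)
      then have "card (e \<union> c) = d"
        using c fin assms(4) by (auto simp: nsets_def card_Un_disjoint)
      then show "e \<union> c \<in> {h \<in> nsets V d. h - C = e}"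
        using c fin assms(1,3) by (auto simp: nsets_def)
    qed
    show "(\<lambda>h. h \<inter> C) \<in> {h \<in> nsets V d. h - C = e} \<rightarrow> nsets C (d - card e)"
    proof
      fix h assume h: "h \<in> {h \<in> nsets V d. h - C = e}"
      then have "h = e \<union> (h \<inter> C)" "e \<inter> (h \<inter> C) = {}" by auto
      then have "card h = card e + card (h \<inter> C)"
        using fin by (metis card_Un_disjoint finite_Int)
      then show "h \<inter> C \<in> nsets C (d - card e)" using h fin by (auto simp: nsets_def)
    qed
  qed (use assms(3) in \<open>auto simp: nsets_def\<close>)
  then have "card {h \<in> nsets V d. h - C = e} = card (nsets C (d - card e))"
    by (rule bij_betw_same_card[symmetric])
  also have "nsets C (d - card e) = {N. N \<subseteq> C \<and> card N = d - card e}"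
    using fin by (auto simp: nsets_def intro: finite_subset)
  finally show ?thesis using fin by (simp add: n_subsets)
qed

text \<open>The traces of a random hypergraph outside \<open>C\<close> are independent, since the possible hyperedges
  with different traces are different.\<close>

lemma prob_traces:
  assumes p: "p \<in> {0..1}" and C: "C \<subseteq> {1..n}" and "finite E"
    and E: "\<And>e. e \<in> E \<Longrightarrow> e \<subseteq> {1..n} - C \<and> card e \<le> d"
  shows "measure_pmf.prob (random_hypergraph d n p) {H. E \<subseteq> (\<lambda>h. h - C) ` H}
    = (\<Prod>e\<in>E. 1 - (1 - p) ^ (card C choose (d - card e)))"
proof -
  let ?I = "nsets {1..n} d"
  define K where "K e = {h \<in> ?I. h - C = e}" for e
  let ?J = "\<Union>e\<in>E. K e"
  have fI: "finite ?I" by (simp add: finite_imp_finite_nsets)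
  have JI: "?J \<subseteq> ?I" by (auto simp: K_def)
  have "measure_pmf.prob (random_hypergraph d n p) {H. E \<subseteq> (\<lambda>h. h - C) ` H}
      = measure_pmf.prob (Pi_pmf ?I False (\<lambda>_. bernoulli_pmf p)) {f. \<forall>e\<in>E. \<exists>h\<in>K e. f h}"
    unfolding random_hypergraph_def by (auto simp: K_def intro!: arg_cong[where f = "measure _"])
  \<comment> \<open>The event looks only at coordinates in the fibres \<open>K e\<close>, so the law
    may be restricted to their union.\<close>
  also have "\<dots> = measure_pmf.prob (Pi_pmf ?J False (\<lambda>_. bernoulli_pmf p)) {f. \<forall>e\<in>E. \<exists>h\<in>K e. f h}"
    unfolding Pi_pmf_subset[OF fI JI] measure_map_pmf
    by (intro arg_cong[where f = "measure _"]) (unfold vimage_def UN_iff, auto, blast+)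
  also have "\<dots> = (\<Prod>e\<in>E. 1 - (1 - p) ^ card (K e))"
    using \<open>finite E\<close> p fI by (intro prob_blocks_hit) (auto simp: K_def disjoint_family_on_def)
  also have "\<dots> = (\<Prod>e\<in>E. 1 - (1 - p) ^ (card C choose (d - card e)))"
    unfolding K_def using E C by (intro prod.cong refl) (simp add: card_fibre_Diff)
  finally show ?thesis .
qed

text \<open>A pair changes status only if it loses its last cover \<open>h\<close> or gains its
  first cover \<open>h'\<close>; the two covering hypotheses exclude this.\<close>

lemma Proj_swap:
  assumes "h \<in> H"
    and "\<And>i j. i \<in> h \<Longrightarrow> j \<in> h \<Longrightarrow> i \<noteq> j \<Longrightarrow> {i, j} \<subseteq> h' \<or> (\<exists>g\<in>H - {h}. {i, j} \<subseteq> g)"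
    and "\<And>i j. i \<in> h' \<Longrightarrow> j \<in> h' \<Longrightarrow> i \<noteq> j \<Longrightarrow> {i, j} \<subseteq> h \<or> (\<exists>g\<in>H - {h}. {i, j} \<subseteq> g)"
  shows "Proj n (insert h' (H - {h})) = Proj n H"
proof -
  have "(\<exists>g\<in>insert h' (H - {h}). {i, j} \<subseteq> g) \<longleftrightarrow> (\<exists>g\<in>H. {i, j} \<subseteq> g)" if "i \<noteq> j" for i j
  proof
    assume "\<exists>g\<in>insert h' (H - {h}). {i, j} \<subseteq> g"
    then show "\<exists>g\<in>H. {i, j} \<subseteq> g" using assms(1) assms(3)[of i j] that by blast
  next
    assume "\<exists>g\<in>H. {i, j} \<subseteq> g"
    then obtain g where "g \<in> H" "{i, j} \<subseteq> g" by blast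
    then show "\<exists>g\<in>insert h' (H - {h}). {i, j} \<subseteq> g"
      using assms(2)[of i j] that by (cases "g = h") auto
  qed
  then show ?thesis
    unfolding Proj_def by (intro Collect_cong ex_cong1 conj_cong refl) simp_all
qed

section \<open>Sums over pairs of tuples, by the coordinates in which they agree\<close>

lemma sum_Times_Times:
  "(\<Sum>s\<in>A \<times> B. \<Sum>t\<in>A \<times> B. f s t) = (\<Sum>x\<in>A. \<Sum>x'\<in>A. \<Sum>y\<in>B. \<Sum>y'\<in>B. f (x, y) (x', y'))"
proof -
  have "(\<Sum>s\<in>A \<times> B. \<Sum>t\<in>A \<times> B. f s t) = (\<Sum>x\<in>A. \<Sum>y\<in>B. \<Sum>x'\<in>A. \<Sum>y'\<in>B. f (x, y) (x', y'))"
    by (simp add: sum.cartesian_product')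
  also have "\<dots> = (\<Sum>x\<in>A. \<Sum>x'\<in>A. \<Sum>y\<in>B. \<Sum>y'\<in>B. f (x, y) (x', y'))"
    by (intro sum.cong refl sum.swap)
  finally show ?thesis .
qed

lemma sum_sum_eq_cases:
  fixes g :: "bool \<Rightarrow> real"
  assumes "finite A"
  shows "(\<Sum>x\<in>A. \<Sum>y\<in>A. g (x = y)) = real (card A) * ((real (card A) - 1) * g False + g True)"
proof -
  have "(\<Sum>y\<in>A. g (x = y)) = (real (card A) - 1) * g False + g True" if "x \<in> A" for x
  proof -
    have "(\<Sum>y\<in>A. g (x = y)) = g True + (\<Sum>y\<in>A - {x}. g (x = y))"
      using assms that by (subst sum.remove[of A x]) auto
    also have "(\<Sum>y\<in>A - {x}. g (x = y)) = (\<Sum>y\<in>A - {x}. g False)"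
      by (intro sum.cong refl arg_cong[of _ _ g]) auto
    also have "\<dots> = (real (card A) - 1) * g False"
    proof -
      have "card A \<ge> 1" using assms that by (auto simp: Suc_le_eq card_gt_0_iff)
      then show ?thesis using that by (simp add: of_nat_diff)
    qed
    finally show ?thesis by simp
  qed
  then show ?thesis by simp
qed

text \<open>The weight is a product over the coordinates, so the sum factorises. Each coordinate has
  \<open>m\<close> agreeing pairs of weight \<open>t\<close> and \<open>m * (m - 1)\<close>
  disagreeing pairs of weight 1.\<close>

lemma sum_PiE_agreements:
  fixes t :: real
  assumes "finite I" and "\<And>i. i \<in> I \<Longrightarrow> finite (B i)" and "\<And>i. i \<in> I \<Longrightarrow> card (B i) = m"
  shows "(\<Sum>s\<in>PiE I B. \<Sum>s'\<in>PiE I B. t ^ card {i \<in> I. s i = s' i})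
    = (real m * (real m - 1 + t)) ^ card I"
proof -
  let ?f = "\<lambda>y y'. if y = y' then t else 1"
  have "(\<Sum>s\<in>PiE I B. \<Sum>s'\<in>PiE I B. t ^ card {i \<in> I. s i = s' i})
      = (\<Sum>s\<in>PiE I B. \<Sum>s'\<in>PiE I B. \<Prod>i\<in>I. ?f (s i) (s' i))"
    using assms(1) by (intro sum.cong refl) (simp add: prod.If_cases Int_def)
  also have "\<dots> = (\<Sum>s\<in>PiE I B. \<Prod>i\<in>I. \<Sum>y'\<in>B i. ?f (s i) y')"
    using assms(1,2) by (intro sum.cong refl) (subst prod_sum_PiE, auto)
  also have "\<dots> = (\<Prod>i\<in>I. \<Sum>y\<in>B i. \<Sum>y'\<in>B i. ?f y y')"
    using assms(1,2) by (subst prod_sum_PiE) auto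
  also have "\<dots> = (\<Prod>i\<in>I. real m * (real m - 1 + t))"
  proof (intro prod.cong refl)
    fix i assume "i \<in> I"
    then show "(\<Sum>y\<in>B i. \<Sum>y'\<in>B i. ?f y y') = real m * (real m - 1 + t)"
      using sum_sum_eq_cases[of "B i" "\<lambda>b. if b then t else 1"] assms(2,3) by simp
  qed
  finally show ?thesis by simp
qed


subsection \<open>Swaps between vertex blocks\<close>

text \<open>\<open>A0\<close> and \<open>A1\<close> supply the exchanged vertices \<open>a\<close>
  and \<open>b\<close>, the \<open>D = d - 1\<close> blocks \<open>B i\<close> supply the common
  vertices of the two hyperedges, and \<open>C\<close> supplies the remaining \<open>d - 2\<close>
  vertices of each covering hyperedge.\<close>

locale swap_frame =
  fixes d n D m :: nat and p :: real and A0 A1 C :: "nat set" and B :: "nat \<Rightarrow> nat set"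
  assumes d: "d = Suc D" and D: "D \<ge> 2" and m: "m \<ge> d" and p: "0 < p" "p < 1"
    and vertices: "A0 \<subseteq> {1..n}" "A1 \<subseteq> {1..n}" "C \<subseteq> {1..n}" "\<And>i. i < D \<Longrightarrow> B i \<subseteq> {1..n}"
    and card_parts: "card A0 = m" "card A1 = m" "card C = m" "\<And>i. i < D \<Longrightarrow> card (B i) = m"
    and disj: "A0 \<inter> A1 = {}" "A0 \<inter> C = {}" "A1 \<inter> C = {}"
      "\<And>i. i < D \<Longrightarrow> A0 \<inter> B i = {}" "\<And>i. i < D \<Longrightarrow> A1 \<inter> B i = {}" "\<And>i. i < D \<Longrightarrow> B i \<inter> C = {}"
      "\<And>i j. i < D \<Longrightarrow> j < D \<Longrightarrow> i \<noteq> j \<Longrightarrow> B i \<inter> B j = {}"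
begin

text \<open>Choice functions represent the common \<open>(d - 1)\<close>-sets: each vertex reveals
  its index through its block, and agreements of two choices can be counted by coordinate.\<close>

definition S :: "(nat \<Rightarrow> nat) set" where
  "S = PiE {..<D} B"

definition core :: "nat \<Rightarrow> (nat \<Rightarrow> nat) \<Rightarrow> nat set" where
  "core x s = insert x (s ` {..<D})"

definition links :: "nat \<Rightarrow> nat \<Rightarrow> (nat \<Rightarrow> nat) \<Rightarrow> nat set set" where
  "links a b s = (\<lambda>(x, i). {x, s i}) ` ({a, b} \<times> {..<D})"

text \<open>A link is a trace if some hyperedge consists of it and vertices of \<open>C\<close>. A
  core already has \<open>d\<close> vertices outside \<open>C\<close>, so in a
  \<open>d\<close>-uniform hypergraph it is a trace only if it is itself a hyperedge.\<close>

definition traces :: "nat set set \<Rightarrow> nat set set" where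
  "traces H = (\<lambda>h. h - C) ` H"

definition needed :: "nat \<times> nat \<times> (nat \<Rightarrow> nat) \<Rightarrow> nat set set" where
  "needed = (\<lambda>(a, b, s). insert (core a s) (links a b s))"

definition swappable :: "nat \<times> nat \<times> (nat \<Rightarrow> nat) \<Rightarrow> nat set set \<Rightarrow> bool" where
  "swappable = (\<lambda>(a, b, s) H. insert (core a s) (links a b s) \<subseteq> traces H \<and> core b s \<notin> traces H)"

text \<open>The probability that a given link is a trace: \<open>m choose (d - 2)\<close> potential
  hyperedges have this trace.\<close>

definition q :: real where
  "q = 1 - (1 - p) ^ (m choose (d - 2))"

text \<open>The probability that a set \<open>e\<close> of at most \<open>d\<close> vertices outside
  \<open>C\<close> is a trace: \<open>q\<close> for links and \<open>p\<close> for cores.\<close>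

definition w :: "nat set \<Rightarrow> real" where
  "w e = 1 - (1 - p) ^ (m choose (d - card e))"

section \<open>Cores and links in the blocks\<close>

lemma finite_parts: "finite A0" "finite A1" "finite C" "i < D \<Longrightarrow> finite (B i)"
  using vertices by (meson finite_subset finite_atLeastAtMost)+

lemma S_mem: "s \<in> S \<Longrightarrow> i < D \<Longrightarrow> s i \<in> B i"
  by (auto simp: S_def)

lemma S_eqI: "s \<in> S \<Longrightarrow> s' \<in> S \<Longrightarrow> (\<And>i. i < D \<Longrightarrow> s i = s' i) \<Longrightarrow> s = s'"
  unfolding S_def by (rule PiE_ext) auto

lemma S_inj: "s \<in> S \<Longrightarrow> s' \<in> S \<Longrightarrow> i < D \<Longrightarrow> j < D \<Longrightarrow> s i = s' j \<Longrightarrow> i = j"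
  using disj(7)[of i j] S_mem[of s i] S_mem[of s' j] by auto

lemma A_not_S: "x \<in> A0 \<union> A1 \<Longrightarrow> s \<in> S \<Longrightarrow> i < D \<Longrightarrow> s i \<noteq> x"
  using disj(4,5)[of i] S_mem[of s i] by auto

lemma card_core: "x \<in> A0 \<union> A1 \<Longrightarrow> s \<in> S \<Longrightarrow> card (core x s) = d"
proof -
  assume x: "x \<in> A0 \<union> A1" "s \<in> S"
  have "inj_on s {..<D}" using S_inj[OF x(2) x(2)] by (auto intro: inj_onI)
  then have "card (s ` {..<D}) = D" by (simp add: card_image)
  moreover have "x \<notin> s ` {..<D}" using A_not_S[OF x] by auto
  ultimately show ?thesis by (simp add: core_def d)
qed

lemma core_subset: "x \<in> A0 \<union> A1 \<Longrightarrow> s \<in> S \<Longrightarrow> core x s \<subseteq> {1..n} - C"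
proof -
  assume x: "x \<in> A0 \<union> A1" and s: "s \<in> S"
  have "s i \<in> {1..n} - C" if "i < D" for i
    using S_mem[OF s that] disj(6)[OF that] vertices(4)[OF that] by blast
  moreover have "x \<in> {1..n} - C" using x vertices(1,2) disj(2,3) by blast
  ultimately show ?thesis by (auto simp: core_def)
qed

text \<open>The blocks identify the vertices of a core: the one in \<open>A0 \<union> A1\<close> is
  \<open>x\<close>, and the one in \<open>B i\<close> is \<open>s i\<close>.\<close>

lemma core_inj:
  assumes "x \<in> A0 \<union> A1" "x' \<in> A0 \<union> A1" "s \<in> S" "s' \<in> S" "core x s = core x' s'"
  shows "x = x'" and "s = s'"
proof -
  have "x \<in> core x' s'" using assms(5) by (auto simp: core_def)
  then show "x = x'" using A_not_S[OF assms(1,4)] by (auto simp: core_def)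
  show "s = s'"
  proof (rule S_eqI[OF assms(3,4)])
    fix i assume i: "i < D"
    have "s i \<in> core x' s'" using assms(5) i by (auto simp: core_def)
    moreover have "s i \<noteq> x'" using A_not_S[OF assms(2,3) i] by auto
    ultimately obtain j where "j < D" "s i = s' j" by (auto simp: core_def)
    then show "s i = s' i" using S_inj[OF assms(3,4) i] by auto
  qed
qed

lemma card_link: "a \<in> A0 \<Longrightarrow> b \<in> A1 \<Longrightarrow> s \<in> S \<Longrightarrow> e \<in> links a b s \<Longrightarrow> card e = 2"
proof -
  assume t: "a \<in> A0" "b \<in> A1" "s \<in> S" and "e \<in> links a b s"
  then obtain x i where "x \<in> {a, b}" "i < D" "e = {x, s i}" by (auto simp: links_def)
  then show ?thesis using A_not_S[of x s i] t by auto
qed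

lemma links_subset: "a \<in> A0 \<Longrightarrow> b \<in> A1 \<Longrightarrow> s \<in> S \<Longrightarrow> e \<in> links a b s \<Longrightarrow> e \<subseteq> {1..n} - C"
  using core_subset[of a s] core_subset[of b s] by (auto simp: links_def core_def)

text \<open>Cores have \<open>d \<ge> 3\<close> vertices and links have two.\<close>

lemma core_notin_links:
  assumes "x \<in> A0 \<union> A1" "s' \<in> S" "a \<in> A0" "b \<in> A1" "s \<in> S"
  shows "core x s' \<notin> links a b s"
  using card_core[OF assms(1,2)] card_link[OF assms(3-5)] D d by fastforce

lemma link_eq:
  assumes "x \<in> A0 \<union> A1" "x' \<in> A0 \<union> A1" "s \<in> S" "s' \<in> S" "i < D" "j < D"
    and "{x, s i} = {x', s' j}"
  shows "x = x'" "i = j" "s i = s' i"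
proof -
  have "x = x' \<and> s i = s' j"
    using assms(7) A_not_S[OF assms(1,4,6)] by (auto simp: doubleton_eq_iff)
  then show "x = x'" "i = j" "s i = s' i" using S_inj[OF assms(3-6)] by auto
qed

lemma card_links:
  assumes "a \<in> A0" "b \<in> A1" "s \<in> S"
  shows "card (links a b s) = 2 * D"
proof -
  have "inj_on (\<lambda>(x, i). {x, s i}) ({a, b} \<times> {..<D})"
  proof (rule inj_onI)
    fix z z' assume "z \<in> {a, b} \<times> {..<D}" "z' \<in> {a, b} \<times> {..<D}" "(\<lambda>(x, i). {x, s i}) z = (\<lambda>(x, i). {x, s i}) z'"
    moreover obtain x i x' j where "z = (x, i)" "z' = (x', j)" by (metis surj_pair)
    ultimately show "z = z'"
      using link_eq(1,2)[of x x' s s i j] assms by auto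
  qed
  moreover have "a \<noteq> b" using assms disj by auto
  ultimately show ?thesis by (simp add: links_def card_image card_cartesian_product)
qed

text \<open>A common link amounts to a common end and a coordinate where \<open>s\<close> and
  \<open>s'\<close> agree. As \<open>A0\<close> and \<open>A1\<close> are disjoint, common ends come
  only from \<open>a = a'\<close> and \<open>b = b'\<close>.\<close>

lemma card_links_Int:
  assumes t: "a \<in> A0" "b \<in> A1" "s \<in> S" "a' \<in> A0" "b' \<in> A1" "s' \<in> S"
  shows "card (links a b s \<inter> links a' b' s')
    = (of_bool (a = a') + of_bool (b = b')) * card {i \<in> {..<D}. s i = s' i}"
proof -
  let ?I = "({a, b} \<inter> {a', b'}) \<times> {i \<in> {..<D}. s i = s' i}"
  have "links a b s \<inter> links a' b' s' = (\<lambda>(x, i). {x, s i}) ` ?I"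
  proof
    show "links a b s \<inter> links a' b' s' \<subseteq> (\<lambda>(x, i). {x, s i}) ` ?I"
    proof
      fix e assume "e \<in> links a b s \<inter> links a' b' s'"
      then obtain z z' where z: "z \<in> {a, b} \<times> {..<D}" "z' \<in> {a', b'} \<times> {..<D}"
        "e = (\<lambda>(x, i). {x, s i}) z" "e = (\<lambda>(x, i). {x, s' i}) z'"
        unfolding links_def by (elim IntE imageE) (rule that)
      obtain x i x' j where "z = (x, i)" "z' = (x', j)" by (metis surj_pair)
      with z have e: "x \<in> {a, b}" "i < D" "e = {x, s i}" "x' \<in> {a', b'}" "j < D" "e = {x', s' j}"
        by simp_all
      then have "x = x'" "s i = s' i" using link_eq[of x x' s s' i j] t by auto
      then show "e \<in> (\<lambda>(x, i). {x, s i}) ` ?I" using e by (intro image_eqI[of _ _ "(x, i)"]) auto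
    qed
    show "(\<lambda>(x, i). {x, s i}) ` ?I \<subseteq> links a b s \<inter> links a' b' s'"
      by (force simp: links_def)
  qed
  moreover have "inj_on (\<lambda>(x, i). {x, s i}) ?I"
  proof (rule inj_onI)
    fix z z' assume "z \<in> ?I" "z' \<in> ?I" "(\<lambda>(x, i). {x, s i}) z = (\<lambda>(x, i). {x, s i}) z'"
    moreover obtain x i x' j where "z = (x, i)" "z' = (x', j)" by (metis surj_pair)
    ultimately show "z = z'"
      using link_eq(1,2)[of x x' s s i j] t by auto
  qed
  moreover have "card ({a, b} \<inter> {a', b'}) = of_bool (a = a') + of_bool (b = b')"
  proof -
    have "a \<noteq> b" "a \<noteq> b'" "b \<noteq> a'" using t disj(1) by auto
    then show ?thesis by auto
  qed
  ultimately show ?thesis by (simp add: card_image card_cartesian_product)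
qed

section \<open>Probabilities of one swap and of two simultaneous swaps\<close>

lemma q_pos: "0 < q"
proof -
  have "0 < m choose (d - 2)" using m by simp
  then have "(1 - p) ^ (m choose (d - 2)) < 1"
    using p by (intro power_less_one_iff[THEN iffD2]) auto
  then show ?thesis by (simp add: q_def)
qed

lemma w_link: "card e = 2 \<Longrightarrow> w e = q" and w_core: "card e = d \<Longrightarrow> w e = p"
  by (simp_all add: w_def q_def)

lemma prob_needed:
  assumes "finite E" "\<And>e. e \<in> E \<Longrightarrow> e \<subseteq> {1..n} - C \<and> card e \<le> d"
  shows "measure_pmf.prob (random_hypergraph d n p) {H. E \<subseteq> traces H} = prod w E"
  unfolding traces_def using prob_traces[of p C n E d] assms p vertices(3) card_parts(3)
  by (simp add: w_def[abs_def])

lemma needed_props: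
  assumes "a \<in> A0" "b \<in> A1" "s \<in> S"
  shows "finite (needed (a, b, s))"
    and "e \<in> needed (a, b, s) \<Longrightarrow> e \<subseteq> {1..n} - C \<and> card e \<le> d"
    and "prod w (needed (a, b, s)) = q ^ (2 * D) * p"
proof -
  show fin: "finite (needed (a, b, s))" by (auto simp: needed_def links_def)
  show "e \<in> needed (a, b, s) \<Longrightarrow> e \<subseteq> {1..n} - C \<and> card e \<le> d"
    using links_subset[OF assms] card_link[OF assms] core_subset[of a s] card_core[of a s] assms d D
    by (auto simp: needed_def)
  have "prod w (links a b s) = (\<Prod>e\<in>links a b s. q)"
    using card_link[OF assms] by (intro prod.cong refl) (simp add: w_link)
  then show "prod w (needed (a, b, s)) = q ^ (2 * D) * p"
    using core_notin_links[of a s a b s] assms fin w_core[OF card_core[of a s]]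
    by (simp add: needed_def card_links)
qed

text \<open>Absence of \<open>core b s\<close> is handled by subtracting the event that it is
  present as well, since the product formula concerns presence only.\<close>

lemma prob_swappable:
  assumes "a \<in> A0" "b \<in> A1" "s \<in> S"
  shows "measure_pmf.prob (random_hypergraph d n p) {H. swappable (a, b, s) H}
    = q ^ (2 * D) * p * (1 - p)"
proof -
  let ?P = "random_hypergraph d n p" and ?E = "needed (a, b, s)"
  have notin: "core b s \<notin> ?E"
    using core_notin_links[of b s a b s] core_inj(1)[of b a s s] assms disj(1)
    by (auto simp: needed_def)
  have "{H. swappable (a, b, s) H} = {H. ?E \<subseteq> traces H} - {H. insert (core b s) ?E \<subseteq> traces H}"
    by (auto simp: swappable_def needed_def)
  then have "measure_pmf.prob ?P {H. swappable (a, b, s) H}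
      = measure_pmf.prob ?P {H. ?E \<subseteq> traces H}
        - measure_pmf.prob ?P {H. insert (core b s) ?E \<subseteq> traces H}"
    by (simp add: measure_pmf.finite_measure_Diff Collect_mono)
  also have "\<dots> = prod w ?E - prod w (insert (core b s) ?E)"
    using needed_props[OF assms] core_subset[of b s] card_core[of b s] assms
    by (subst (1 2) prob_needed) auto
  also have "\<dots> = q ^ (2 * D) * p * (1 - p)"
    using needed_props[OF assms] notin w_core[OF card_core[of b s]] assms
    by (simp add: algebra_simps)
  finally show ?thesis .
qed

text \<open>After dropping the absence conditions, the probability is the product of the two
  separate ones divided by the weight of the shared traces. Each shared link gains a factor
  \<open>1 / q\<close>. A shared core gains \<open>1 / p\<close>; it forces \<open>a = a'\<close>
  and \<open>s = s'\<close>, so all \<open>D\<close> coordinates agree, which is the second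
  summand.\<close>

lemma prob_swappable_pair:
  assumes t: "a \<in> A0" "b \<in> A1" "s \<in> S" "a' \<in> A0" "b' \<in> A1" "s' \<in> S"
  shows "measure_pmf.prob (random_hypergraph d n p) {H. swappable (a, b, s) H \<and> swappable (a', b', s') H}
    \<le> (q ^ (2 * D) * p)\<^sup>2 *
      (((1 / q) ^ (of_bool (a = a') + of_bool (b = b'))) ^ card {i \<in> {..<D}. s i = s' i}
        + of_bool (a = a') * of_bool (s = s') * ((1 / q) ^ (of_bool (a = a') + of_bool (b = b'))) ^ D / p)"
    (is "?lhs \<le> ?c * (?r ^ ?k + _)")
proof -
  let ?E = "needed (a, b, s)" and ?E' = "needed (a', b', s')"
  let ?X = "links a b s \<inter> links a' b' s'"
  have pos: "0 < w e" if "e \<in> ?E" for e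
  proof -
    have "w e = q \<or> w e = p"
      using that card_link[OF t(1-3)] w_link[of e] w_core[OF card_core[of a s]] t
      by (auto simp: needed_def)
    then show ?thesis using q_pos p(1) by auto
  qed
  have finX: "finite ?X" by (auto simp: links_def)
  have "?lhs \<le> measure_pmf.prob (random_hypergraph d n p) {H. ?E \<union> ?E' \<subseteq> traces H}"
    by (intro measure_pmf.finite_measure_mono) (auto simp: swappable_def needed_def)
  also have "\<dots> = prod w (?E \<union> ?E')"
    using needed_props[OF t(1-3)] needed_props[OF t(4-6)] by (intro prob_needed) auto
  also have "\<dots> = ?c / prod w (?E \<inter> ?E')"
  proof -
    have "prod w (?E \<union> ?E') * prod w (?E \<inter> ?E') = ?c"
      using needed_props[OF t(1-3)] needed_props[OF t(4-6)]
      by (subst prod.union_inter) (simp_all add: power2_eq_square)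
    moreover have "prod w (?E \<inter> ?E') > 0" using pos by (intro prod_pos) auto
    ultimately show ?thesis by (simp add: field_simps)
  qed
  also have "\<dots> \<le> ?c * (?r ^ ?k + of_bool (a = a') * of_bool (s = s') * ?r ^ D / p)"
  proof -
    have X: "prod w ?X = q ^ card ?X"
      using card_link[OF t(1-3)] by (simp add: w_link)
    have rX: "1 / q ^ card ?X = ?r ^ ?k"
      unfolding card_links_Int[OF t] by (simp add: power_mult power_one_over)
    have r0: "?r > 0" using q_pos by simp
    have "1 / prod w (?E \<inter> ?E') \<le> ?r ^ ?k + of_bool (a = a') * of_bool (s = s') * ?r ^ D / p"
    proof (cases "core a s = core a' s'")
      case False
      then have "?E \<inter> ?E' = ?X"
        using core_notin_links[of a s a' b' s'] core_notin_links[of a' s' a b s] t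
        by (auto simp: needed_def)
      then show ?thesis using X rX r0 p by simp
    next
      case True
      then have eq: "a = a'" "s = s'" using core_inj[of a a' s s'] t by auto
      have "?E \<inter> ?E' = insert (core a s) ?X"
        using True core_notin_links[of a s a' b' s'] core_notin_links[of a' s' a b s] t
        by (auto simp: needed_def)
      moreover have "core a s \<notin> ?X" using core_notin_links[of a s a b s] t by auto
      ultimately have "prod w (?E \<inter> ?E') = p * q ^ card ?X"
        using finX X w_core[OF card_core[of a s]] t by simp
      then have "1 / prod w (?E \<inter> ?E') = ?r ^ ?k / p" using rX by (simp add: field_simps)
      moreover have "?k = D" using eq by simp
      ultimately show ?thesis using eq r0 by simp
    qed
    then have "?c * (1 / prod w (?E \<inter> ?E')) \<le>
        ?c * (?r ^ ?k + of_bool (a = a') * of_bool (s = s') * ?r ^ D / p)"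
      by (rule mult_left_mono) simp
    then show ?thesis by simp
  qed
  finally show ?thesis .
qed

section \<open>Swaps inside the ambiguity class\<close>

text \<open>A pair inside a core either lies in the image of \<open>s\<close>, hence in both cores,
  or is a link. The hyperedge behind a link has a trace of size 2, so it differs from
  \<open>core a s\<close> and survives the swap.\<close>

lemma Proj_core_swap:
  assumes t: "a \<in> A0" "b \<in> A1" "s \<in> S" and H: "H \<in> uniform_hypergraphs d n"
    and sw: "swappable (a, b, s) H"
  shows "core a s \<in> H" and "core b s \<notin> H"
    and "Proj n (insert (core b s) (H - {core a s})) = Proj n H"
proof -
  have noC: "core x s - C = core x s" if "x \<in> {a, b}" for x
    using core_subset[of x s] that t by auto
  obtain h where h: "h \<in> H" "core a s = h - C"
    using sw by (auto simp: swappable_def traces_def)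
  have "finite h" "card h = d" using h H by (auto simp: uniform_hypergraphs_def nsets_def)
  moreover have "core a s \<subseteq> h" "card (core a s) = d" using h card_core[of a s] t by auto
  ultimately have "core a s = h" by (intro card_subset_eq) auto
  then show a: "core a s \<in> H" using h by simp
  show "core b s \<notin> H" using sw noC[of b] by (force simp: swappable_def traces_def)
  have link: "\<exists>g\<in>H - {core a s}. {x, s i} \<subseteq> g" if "x \<in> {a, b}" "i < D" for x i
  proof -
    have e: "{x, s i} \<in> links a b s" using that by (auto simp: links_def)
    then obtain g where g: "g \<in> H" "{x, s i} = g - C"
      using sw by (auto simp: swappable_def traces_def)
    moreover have "g \<noteq> core a s"
      using noC[of a] card_link[OF t e] card_core[of a s] t d D g by auto
    ultimately show ?thesis by blast
  qed
  have pairs: "{i, j} \<subseteq> core y s \<or> (\<exists>g\<in>H - {core a s}. {i, j} \<subseteq> g)"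
    if x: "x \<in> {a, b}" and ij: "i \<in> core x s" "j \<in> core x s" "i \<noteq> j" for x y i j
  proof -
    consider k where "k < D" "{i, j} = {x, s k}" | "{i, j} \<subseteq> s ` {..<D}"
      using ij by (auto simp: core_def doubleton_eq_iff)
    then show ?thesis
    proof cases
      case 1
      then show ?thesis using link[OF x, of k] by simp
    next
      case 2
      then show ?thesis unfolding core_def by blast
    qed
  qed
  show "Proj n (insert (core b s) (H - {core a s})) = Proj n H"
    using pairs[of a _ _ b] pairs[of b _ _ a] by (intro Proj_swap a) simp_all
qed

text \<open>Performing the swap maps the available triples injectively into the class: the
  hyperedges removed and added determine \<open>a\<close>, \<open>b\<close> and \<open>s\<close>.
  The inequality is strict because \<open>H\<close> itself is in the class but is not
  reached.\<close>

lemma card_swappable_less: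
  assumes H: "H \<in> uniform_hypergraphs d n"
  shows "card {t \<in> A0 \<times> A1 \<times> S. swappable t H} < card (ambiguity_class d n p H)"
proof -
  let ?T = "{t \<in> A0 \<times> A1 \<times> S. swappable t H}"
  define f where "f = (\<lambda>(a, b, s). insert (core b s) (H - {core a s}))"
  have fin: "finite (ambiguity_class d n p H)"
    by (simp add: ambiguity_class_def finite_uniform_hypergraphs)
  have diffs: "H - f t = {core a s}" "f t - H = {core b s}"
    if "t \<in> ?T" "t = (a, b, s)" for t a b s
    using that Proj_core_swap[of a b s H] H by (auto simp: f_def)
  have "inj_on f ?T"
  proof (intro inj_onI)
    fix t t' assume tt: "t \<in> ?T" "t' \<in> ?T" and eq: "f t = f t'"
    obtain a b s a' b' s' where t: "t = (a, b, s)" "t' = (a', b', s')"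
      by (metis prod_cases3)
    have "core a s = core a' s'" "core b s = core b' s'"
      using diffs[OF tt(1) t(1)] diffs[OF tt(2) t(2)] eq by auto
    moreover have "a \<in> A0" "a' \<in> A0" "b \<in> A1" "b' \<in> A1" "s \<in> S" "s' \<in> S"
      using tt t by auto
    ultimately have "a = a'" "b = b'" "s = s'"
      using core_inj(1)[of a a' s s'] core_inj(1)[of b b' s s'] core_inj(2)[of a a' s s'] by simp_all
    then show "t = t'" using t by simp
  qed
  moreover have "f ` ?T \<subseteq> ambiguity_class d n p H - {H}"
  proof
    fix H' assume "H' \<in> f ` ?T"
    then obtain a b s where tT: "(a, b, s) \<in> ?T" and H': "H' = insert (core b s) (H - {core a s})"
      by (auto simp: f_def)
    then have t: "a \<in> A0" "b \<in> A1" "s \<in> S" and sw: "swappable (a, b, s) H" by auto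
    note cs = Proj_core_swap[OF t H sw]
    have "finite H" using H finite_imp_finite_nsets[of "{1..n}" d]
      by (auto simp: uniform_hypergraphs_def intro: finite_subset)
    then have "card H' = card H" using cs card_Suc_Diff1[of H "core a s"]
      by (simp add: H' del: card_Diff_insert card_Diff_singleton)
    moreover have "core b s \<in> nsets {1..n} d"
      using core_subset[of b s] card_core[of b s] t by (auto simp: nsets_def core_def)
    then have "H' \<in> uniform_hypergraphs d n"
      using H by (auto simp: H' uniform_hypergraphs_def)
    ultimately show "H' \<in> ambiguity_class d n p H - {H}"
      using cs H by (auto simp: ambiguity_class_def pmf_random_hypergraph H')
  qed
  ultimately have "card ?T \<le> card (ambiguity_class d n p H - {H})"
    using fin by (intro card_inj_on_le) auto
  moreover have "H \<in> ambiguity_class d n p H" using H by (simp add: ambiguity_class_def)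
  ultimately show ?thesis using fin
    by (meson card_Diff1_less le_less_trans)
qed

end


subsection \<open>The second moment of the number of swaps\<close>

text \<open>
  With blocks of size \<open>1 / x\<close>, probability \<open>1 / r\<close> for a pair to be covered, and hyperedge probability
  \<open>1 / v\<close>, the three terms are the contributions to \<open>E N\<^sup>2\<close>, relative to \<open>(E N)\<^sup>2\<close>, of two swaps sharing
  one of \<open>a\<close> and \<open>b\<close>, of two swaps sharing both, and of two swaps sharing \<open>S\<close> and \<open>a\<close>.
\<close>

definition pair_excess :: "nat \<Rightarrow> real \<Rightarrow> real \<Rightarrow> real \<Rightarrow> real" where
  "pair_excess D x r v = 2 * x * (1 + r * x) ^ D + x\<^sup>2 * (1 + r\<^sup>2 * x) ^ D + r ^ D * v * x ^ (D + 1)"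

context swap_frame
begin

lemma card_S: "card S = m ^ D"
  using card_parts(4) by (simp add: S_def card_PiE)

lemma finite_S: "finite S"
  using finite_parts(4) by (auto simp: S_def intro!: finite_PiE)

lemma sum_prob_swappable:
  "(\<Sum>t\<in>A0 \<times> A1 \<times> S. measure_pmf.prob (random_hypergraph d n p) {H. swappable t H})
    = real m ^ (D + 2) * q ^ (2 * D) * p * (1 - p)"
proof -
  have "(\<Sum>t\<in>A0 \<times> A1 \<times> S. measure_pmf.prob (random_hypergraph d n p) {H. swappable t H})
      = (\<Sum>t\<in>A0 \<times> A1 \<times> S. q ^ (2 * D) * p * (1 - p))"
    by (intro sum.cong refl) (auto simp: prob_swappable)
  then show ?thesis
    by (simp add: card_cartesian_product card_parts card_S power_add power2_eq_square)
qed

text \<open>Pairs of swaps are grouped by whether \<open>a = a'\<close> and whether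
  \<open>b = b'\<close>. Sharing neither gives the leading 1, and a swap paired with itself gives
  \<open>1 / \<mu>\<close>.\<close>

lemma sum_prob_swappable_pair:
  defines "\<mu> \<equiv> real m ^ (D + 2) * q ^ (2 * D) * p"
  shows "(\<Sum>t\<in>A0 \<times> A1 \<times> S. \<Sum>t'\<in>A0 \<times> A1 \<times> S.
      measure_pmf.prob (random_hypergraph d n p) {H. swappable t H \<and> swappable t' H})
    \<le> \<mu>\<^sup>2 * (1 + pair_excess D (1 / m) (1 / q) (1 / p) + 1 / \<mu>)"
proof -
  let ?c = "(q ^ (2 * D) * p)\<^sup>2" and ?r = "1 / q" and ?x = "real m"
  let ?J = "\<lambda>u v. of_bool u + of_bool v :: nat"
  let ?k = "\<lambda>s s'. card {i \<in> {..<D}. s i = s' i}"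
  let ?F = "\<lambda>u v e k. ?c * ((?r ^ ?J u v) ^ k + of_bool u * of_bool e * (?r ^ ?J u v) ^ D / p)"
  \<comment> \<open>The value of the sum over \<open>s\<close> and \<open>s'\<close> when
    \<open>u\<close> and \<open>v\<close> are the truth values of \<open>a = a'\<close> and
    \<open>b = b'\<close>.\<close>
  define G where "G u v = ?c * ((?x * (?x - 1 + ?r ^ ?J u v)) ^ D + of_bool u * ?x ^ D * (?r ^ ?J u v) ^ D / p)"
    for u v
  have x: "?x \<ge> 1" using m d by simp
  have r: "?r \<ge> 0" using q_pos by simp
  have G0: "G u v \<ge> 0" for u v
    unfolding G_def using x r p by (intro mult_nonneg_nonneg add_nonneg_nonneg) auto
  have S_sum: "(\<Sum>s\<in>S. \<Sum>s'\<in>S. ?F u v (s = s') (?k s s')) = G u v" for u v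
  proof -
    have "(\<Sum>s\<in>S. \<Sum>s'\<in>S. ?F u v (s = s') (?k s s'))
       = ?c * ((\<Sum>s\<in>S. \<Sum>s'\<in>S. (?r ^ ?J u v) ^ ?k s s')
          + (\<Sum>s\<in>S. \<Sum>s'\<in>S. of_bool u * of_bool (s = s') * (?r ^ ?J u v) ^ D / p))"
      by (simp only: sum_distrib_left[symmetric] sum.distrib)
    also have "(\<Sum>s\<in>S. \<Sum>s'\<in>S. (?r ^ ?J u v) ^ ?k s s') = (?x * (?x - 1 + ?r ^ ?J u v)) ^ D"
      unfolding S_def using finite_parts(4) card_parts(4)
      by (subst sum_PiE_agreements[where m = m]) auto
    also have "(\<Sum>s\<in>S. \<Sum>s'\<in>S. of_bool u * of_bool (s = s') * (?r ^ ?J u v) ^ D / p)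
        = of_bool u * ?x ^ D * (?r ^ ?J u v) ^ D / p"
      using sum_sum_eq_cases[OF finite_S, of "\<lambda>e. of_bool u * of_bool e * (?r ^ ?J u v) ^ D / p"]
      by (simp add: card_S)
    finally show ?thesis by (simp add: G_def)
  qed
  have "(\<Sum>t\<in>A0 \<times> A1 \<times> S. \<Sum>t'\<in>A0 \<times> A1 \<times> S.
      measure_pmf.prob (random_hypergraph d n p) {H. swappable t H \<and> swappable t' H})
    = (\<Sum>a\<in>A0. \<Sum>a'\<in>A0. \<Sum>b\<in>A1. \<Sum>b'\<in>A1. \<Sum>s\<in>S. \<Sum>s'\<in>S.
      measure_pmf.prob (random_hypergraph d n p) {H. swappable (a, b, s) H \<and> swappable (a', b', s') H})"
    by (simp only: sum_Times_Times)
  also have "\<dots> \<le> (\<Sum>a\<in>A0. \<Sum>a'\<in>A0. \<Sum>b\<in>A1. \<Sum>b'\<in>A1. \<Sum>s\<in>S. \<Sum>s'\<in>S.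
      ?F (a = a') (b = b') (s = s') (?k s s'))"
    by (intro sum_mono prob_swappable_pair)
  also have "\<dots> = (\<Sum>a\<in>A0. \<Sum>a'\<in>A0. \<Sum>b\<in>A1. \<Sum>b'\<in>A1. G (a = a') (b = b'))"
    by (simp only: S_sum)
  also have "\<dots> = (\<Sum>a\<in>A0. \<Sum>a'\<in>A0. ?x * ((?x - 1) * G (a = a') False + G (a = a') True))"
    by (simp only: sum_sum_eq_cases[OF finite_parts(2), where g = "G _"] card_parts)
  also have "\<dots> = ?x * ((?x - 1) * (?x * ((?x - 1) * G False False + G False True))
      + ?x * ((?x - 1) * G True False + G True True))"
    using sum_sum_eq_cases[OF finite_parts(1), of "\<lambda>u. ?x * ((?x - 1) * G u False + G u True)"]
    by (simp only: card_parts)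
  also have "\<dots> \<le> ?x * (?x * (?x * (?x * G False False + G False True))
      + ?x * (?x * G True False + G True True))"
    using x G0 by (intro mult_left_mono add_mono mult_mono mult_right_mono add_nonneg_nonneg
        mult_nonneg_nonneg) auto
  also have "\<dots> \<le> \<mu>\<^sup>2 * (1 + pair_excess D (1 / m) (1 / q) (1 / p) + 1 / \<mu>)"
  proof -
    have pw: "(?x * (?x - 1 + y)) ^ D \<le> (?x ^ D)\<^sup>2 * (1 + y / ?x) ^ D" if "y \<ge> 0" for y
    proof -
      have "?x * (?x - 1 + y) \<le> ?x\<^sup>2 * (1 + y / ?x)"
        using x by (simp add: power2_eq_square field_simps)
      then have "(?x * (?x - 1 + y)) ^ D \<le> (?x\<^sup>2 * (1 + y / ?x)) ^ D"
        using x that by (intro power_mono) auto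
      then show ?thesis by (simp add: power_mult_distrib flip: power_mult power_mult_distrib)
          (simp add: power_mult_distrib mult.commute flip: power_mult)
    qed
    \<comment> \<open>Without a common end there are no common links, so this term is exact. The
      leading coefficient must be 1 for the failure probability to tend to 1 above the
      threshold.\<close>
    have FF: "G False False = ?c * (?x ^ D)\<^sup>2"
      by (simp add: G_def power2_eq_square power_mult_distrib)
    have FT: "G False True \<le> ?c * ((?x ^ D)\<^sup>2 * (1 + ?r / ?x) ^ D)"
      using pw[OF r] by (simp add: G_def mult_left_mono)
    have TF: "G True False \<le> ?c * ((?x ^ D)\<^sup>2 * (1 + ?r / ?x) ^ D + ?x ^ D * ?r ^ D / p)"
      unfolding G_def using pw[OF r] by (intro mult_left_mono add_mono) auto
    have TT: "G True True \<le> ?c * ((?x ^ D)\<^sup>2 * (1 + ?r\<^sup>2 / ?x) ^ D + ?x ^ D * (?r\<^sup>2) ^ D / p)"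
      unfolding G_def using pw[of "?r\<^sup>2"]
      by (intro mult_left_mono add_mono) (auto simp: numeral_2_eq_2)
    have "?x * (?x * (?x * (?x * G False False + G False True)) + ?x * (?x * G True False + G True True))
      \<le> ?x * (?x * (?x * (?x * (?c * (?x ^ D)\<^sup>2) + ?c * ((?x ^ D)\<^sup>2 * (1 + ?r / ?x) ^ D)))
        + ?x * (?x * (?c * ((?x ^ D)\<^sup>2 * (1 + ?r / ?x) ^ D + ?x ^ D * ?r ^ D / p))
          + ?c * ((?x ^ D)\<^sup>2 * (1 + ?r\<^sup>2 / ?x) ^ D + ?x ^ D * (?r\<^sup>2) ^ D / p)))"
      using FF FT TF TT x by (intro mult_left_mono add_mono) auto
    also have "\<dots> = \<mu>\<^sup>2 * (1 + pair_excess D (1 / m) (1 / q) (1 / p) + 1 / \<mu>)"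
    proof -
      define y where "y = ?x ^ D"
      define z where "z = q ^ D"
      define w1 where "w1 = (1 + ?r / ?x) ^ D"
      define w2 where "w2 = (1 + ?r\<^sup>2 / ?x) ^ D"
      have nz: "y \<noteq> 0" "z \<noteq> 0" "?x \<noteq> 0" "p \<noteq> 0" using x q_pos p by (auto simp: y_def z_def)
      have 1: "q ^ (2 * D) = z\<^sup>2" by (simp add: z_def power_even_eq)
      have 2: "?r ^ D = 1 / z" "(?r\<^sup>2) ^ D = 1 / z\<^sup>2" "?x ^ (D + 2) = y * ?x\<^sup>2"
        "(1 / ?x) ^ (D + 1) = 1 / (y * ?x)" "1 + ?r * (1 / ?x) = 1 + ?r / ?x"
        "1 + ?r\<^sup>2 * (1 / ?x) = 1 + ?r\<^sup>2 / ?x"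
        by (simp_all add: z_def y_def power_one_over power_add power2_eq_square power_mult_distrib mult_ac)
      show ?thesis
        unfolding \<mu>_def pair_excess_def 1 2 y_def[symmetric] w1_def[symmetric] w2_def[symmetric]
        using nz by (simp add: field_simps power2_eq_square)
    qed
    finally show ?thesis .
  qed
  finally show ?thesis .
qed

text \<open>The last summand of the denominator is \<open>2 / \<mu>\<close>: one
  \<open>1 / \<mu>\<close> comes from the second moment, the other from the first, which is at most
  \<open>\<mu>\<close>.\<close>

lemma recovery_failure_ge:
  "(1 - p)\<^sup>2 / (1 + pair_excess D (1 / m) (1 / q) (1 / p)
      + 2 * ((1 / q) ^ (2 * D) * (1 / p) * (1 / real m) ^ (D + 2)))
    \<le> 1 - exact_recovery_prob d n p"
proof -
  define \<mu> where "\<mu> = real m ^ (D + 2) * q ^ (2 * D) * p"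
  let ?\<eta> = "pair_excess D (1 / m) (1 / q) (1 / p)"
  let ?s1 = "\<Sum>t\<in>A0 \<times> A1 \<times> S. measure_pmf.prob (random_hypergraph d n p) {H. swappable t H}"
  let ?s2 = "\<Sum>t\<in>A0 \<times> A1 \<times> S. \<Sum>t'\<in>A0 \<times> A1 \<times> S.
      measure_pmf.prob (random_hypergraph d n p) {H. swappable t H \<and> swappable t' H}"
  have \<mu>: "\<mu> > 0" using m d q_pos p by (simp add: \<mu>_def)
  have \<eta>: "?\<eta> \<ge> 0" using q_pos p by (simp add: pair_excess_def)
  have s1: "?s1 = \<mu> * (1 - p)" by (simp add: sum_prob_swappable \<mu>_def)
  have s2: "?s2 \<le> \<mu>\<^sup>2 * (1 + ?\<eta> + 1 / \<mu>)" using sum_prob_swappable_pair by (simp add: \<mu>_def)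
  have s2_0: "?s2 \<ge> 0" by (intro sum_nonneg) simp
  have s1_pos: "?s1 > 0" using s1 \<mu> p by simp
  have "(1 - p)\<^sup>2 / (1 + ?\<eta> + 2 * (1 / \<mu>)) = ?s1\<^sup>2 / (\<mu>\<^sup>2 * (1 + ?\<eta> + 2 * (1 / \<mu>)))"
    unfolding s1 using \<mu> by (simp add: power_mult_distrib)
  also have "\<dots> \<le> ?s1\<^sup>2 / (?s1 + ?s2)"
  proof (rule divide_left_mono)
    have "?s1 \<le> \<mu>\<^sup>2 * (1 / \<mu>)" unfolding s1 using \<mu> p by (simp add: power2_eq_square)
    then show "?s1 + ?s2 \<le> \<mu>\<^sup>2 * (1 + ?\<eta> + 2 * (1 / \<mu>))" using s2 by (simp add: algebra_simps)
    show "0 < (\<mu>\<^sup>2 * (1 + ?\<eta> + 2 * (1 / \<mu>))) * (?s1 + ?s2)"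
      using \<mu> \<eta> s1_pos s2_0 by (intro mult_pos_pos add_pos_nonneg) auto
  qed simp
  also have "\<dots> \<le> 1 - exact_recovery_prob d n p"
    using finite_parts finite_S s1_pos card_swappable_less
    by (intro recovery_failure_second_moment) auto
  finally show ?thesis by (simp add: \<mu>_def power_one_over mult_ac)
qed

end

lemma Ioc_blocks_disjoint:
  fixes i j m :: nat
  assumes "i \<noteq> j"
  shows "{i * m<..Suc i * m} \<inter> {j * m<..Suc j * m} = {}"
proof -
  have "Suc i * m \<le> j * m \<or> Suc j * m \<le> i * m"
    using assms by (metis Suc_leI mult_le_mono1 nat_neq_iff)
  then show ?thesis by auto
qed

text \<open>The frame consists of \<open>D + 3\<close> consecutive intervals of length
  \<open>m\<close>; the first three serve as \<open>A0\<close>, \<open>A1\<close> and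
  \<open>C\<close>.\<close>

lemma swap_frame_blocks:
  fixes m :: nat
  defines "V \<equiv> \<lambda>i. {i * m<..Suc i * m}"
  assumes "D \<ge> 2" "m \<ge> Suc D" "(D + 3) * m \<le> n" "0 < p" "p < 1"
  shows "swap_frame (Suc D) n D m p (V 0) (V 1) (V 2) (\<lambda>i. V (i + 3))"
proof -
  have sub: "V i \<subseteq> {1..n}" if "i < D + 3" for i
  proof -
    have "Suc i * m \<le> (D + 3) * m" using that by (intro mult_le_mono1) simp
    then have "Suc i * m \<le> n" using assms(4) by linarith
    then show ?thesis by (auto simp: V_def)
  qed
  have card: "card (V i) = m" for i by (simp add: V_def)
  have disj: "V i \<inter> V j = {}" if "i \<noteq> j" for i j
    unfolding V_def using that by (rule Ioc_blocks_disjoint)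
  show ?thesis
    using assms(2-) by unfold_locales (simp_all add: card disj sub[simplified])
qed


subsection \<open>Asymptotics\<close>

text \<open>This follows from
  \<open>(1 - p) ^ M \<le> exp (- p * M) \<le> 1 / (1 + p * M)\<close>.\<close>

lemma inverse_one_minus_power_le:
  fixes p :: real
  assumes "0 < p" "p < 1" "M > 0"
  shows "1 / (1 - (1 - p) ^ M) \<le> 1 + 1 / (p * M)"
proof -
  have pM: "p * M > 0" using assms by simp
  have "(1 - p) ^ M \<le> exp (- p) ^ M"
    using exp_ge_add_one_self[of "- p"] assms by (intro power_mono) auto
  also have "\<dots> = 1 / exp (p * M)"
    unfolding exp_of_nat_mult[symmetric] by (simp add: exp_minus inverse_eq_divide mult.commute)
  also have "\<dots> \<le> 1 / (1 + p * M)"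
    using exp_ge_add_one_self[of "p * M"] pM by (intro divide_left_mono) auto
  finally have le: "p * M / (1 + p * M) \<le> 1 - (1 - p) ^ M"
    using pM by (simp add: field_simps)
  have "1 / (1 - (1 - p) ^ M) \<le> 1 / (p * M / (1 + p * M))"
    using le pM by (intro divide_left_mono mult_pos_pos less_le_trans[OF _ le]) auto
  also have "\<dots> = 1 + 1 / (p * M)" using assms by (simp add: add_divide_distrib)
  finally show ?thesis .
qed

text \<open>Here \<open>m\<close> is the largest length for which \<open>D + 3\<close> blocks fit,
  and \<open>r\<close> is \<open>1 / q\<close>, as \<open>D - 1 = d - 2\<close>.\<close>

lemma recovery_failure_explicit:
  fixes n D :: nat and p :: real
  defines "m \<equiv> n div (D + 3)"
  defines "r \<equiv> 1 / (1 - (1 - p) ^ (m choose (D - 1)))"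
  assumes "D \<ge> 2" "m \<ge> Suc D" "0 < p" "p < 1"
  shows "(1 - p)\<^sup>2 / (1 + pair_excess D (1 / m) r (1 / p)
      + 2 * (r ^ (2 * D) * (1 / p) * (1 / real m) ^ (D + 2)))
    \<le> 1 - exact_recovery_prob (Suc D) n p"
proof -
  define V where "V = (\<lambda>i. {i * m<..Suc i * m})"
  have mn: "(D + 3) * m \<le> n" by (simp add: m_def)
  interpret swap_frame "Suc D" n D m p "V 0" "V 1" "V 2" "\<lambda>i. V (i + 3)"
    unfolding V_def using assms(3-) mn by (intro swap_frame_blocks)
  have "1 / q = r" by (simp add: q_def r_def)
  then show ?thesis using recovery_failure_ge by simp
qed

section \<open>Limits of the error terms\<close>

lemma pair_excess_mono:
  assumes "0 \<le> x" "x \<le> x'" "0 \<le> r" "r \<le> r'" "0 \<le> v" "v \<le> v'"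
  shows "pair_excess D x r v \<le> pair_excess D x' r' v'"
  unfolding pair_excess_def using assms
  by (intro add_mono mult_mono power_mono order_refl mult_nonneg_nonneg add_nonneg_nonneg zero_le_power) auto

lemma powr_tendsto_0:
  assumes "a < 0"
  shows "((\<lambda>n. real n powr a) \<longlongrightarrow> 0) sequentially"
  using assms by (rule tendsto_neg_powr) (rule filterlim_real_sequentially)

text \<open>The arguments are the orders of \<open>1 / m\<close>, \<open>1 / q\<close> and
  \<open>1 / p\<close>. Each of the three terms vanishes already at the threshold value of
  \<open>\<delta>\<close>.\<close>

lemma pair_excess_tendsto_0:
  fixes K \<delta> :: real
  assumes D: "D \<ge> 2" and \<delta>: "\<delta> \<ge> (2 * real D - 2) / (2 * real D + 1)"
  shows "((\<lambda>n. pair_excess D (K * real n powr -1) (K * real n powr (1 - \<delta>)) (K * real n powr (D - \<delta>)))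
    \<longlongrightarrow> 0) sequentially"
proof -
  have Dr: "real D \<ge> 2" using D by simp
  have \<delta>D: "(2 * real D + 1) * \<delta> \<ge> 2 * real D - 2" using \<delta> Dr by (simp add: field_simps)
  have "(2 * real D - 2) / (2 * real D + 1) > 0" using Dr by simp
  then have \<delta>0: "\<delta> > 0" using \<delta> by linarith
  have e2: "1 - 2 * \<delta> - 2 / D < 0"
  proof -
    have "(2 * real D + 1) * (1 - 2 * \<delta>) \<le> 5 - 2 * real D" using \<delta>D by (simp add: algebra_simps)
    also have "\<dots> \<le> 1" using Dr by simp
    also have "\<dots> < (2 * real D + 1) * (2 / D)" using Dr by (simp add: field_simps)
    finally have "1 - 2 * \<delta> < 2 / D" by (rule mult_left_less_imp_less) (use Dr in simp)
    then show ?thesis by simp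
  qed
  \<comment> \<open>This is the exponent of the third term; its sign comes from
    \<open>(D - 1) / (D + 1) < (2 D - 2) / (2 D + 1)\<close>.\<close>
  have e3: "real D - 1 - (real D + 1) * \<delta> < 0"
  proof -
    have "(2 * real D + 1) * (real D - 1) < (real D + 1) * (2 * real D - 2)"
      using Dr by (simp add: algebra_simps)
    also have "\<dots> \<le> (real D + 1) * ((2 * real D + 1) * \<delta>)" using \<delta>D by (intro mult_left_mono) auto
    finally have "(2 * real D + 1) * (real D - 1) < (2 * real D + 1) * ((real D + 1) * \<delta>)"
      by (simp add: algebra_simps)
    then show ?thesis using Dr by (simp add: mult_less_cancel_left_pos)
  qed
  define f1 where "f1 n = 2 * K * real n powr -1 * (1 + K\<^sup>2 * real n powr (- \<delta>)) ^ D" for n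
  \<comment> \<open>As \<open>1 + r^2 * x\<close> may grow, the decay of \<open>x^2\<close> is
    spread over the \<open>D\<close> factors as \<open>n powr (- 2 / D)\<close> each;
    \<open>e2\<close> then makes every factor vanish.\<close>
  define f2 where "f2 n = K\<^sup>2 * (real n powr (- 2 / D) + K ^ 3 * real n powr (1 - 2 * \<delta> - 2 / D)) ^ D" for n
  define f3 where "f3 n = K ^ (2 * D + 2) * real n powr (real D - 1 - (real D + 1) * \<delta>)" for n
  have "(f1 \<longlongrightarrow> 2 * K * 0 * (1 + K\<^sup>2 * 0) ^ D) sequentially"
    unfolding f1_def using \<delta>0 by (intro tendsto_intros powr_tendsto_0) auto
  moreover have "(f2 \<longlongrightarrow> K\<^sup>2 * (0 + K ^ 3 * 0) ^ D) sequentially"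
    unfolding f2_def using e2 Dr by (intro tendsto_intros powr_tendsto_0) auto
  moreover have "(f3 \<longlongrightarrow> K ^ (2 * D + 2) * 0) sequentially"
    unfolding f3_def using e3 by (intro tendsto_intros powr_tendsto_0)
  ultimately have "((\<lambda>n. f1 n + f2 n + f3 n) \<longlongrightarrow>
      2 * K * 0 * (1 + K\<^sup>2 * 0) ^ D + K\<^sup>2 * (0 + K ^ 3 * 0) ^ D + K ^ (2 * D + 2) * 0) sequentially"
    by (intro tendsto_add)
  then have lim: "((\<lambda>n. f1 n + f2 n + f3 n) \<longlongrightarrow> 0) sequentially" using D by (simp add: power_0_left)
  show ?thesis
  proof (rule Lim_transform_eventually[OF lim], rule eventually_mono[OF eventually_gt_at_top[of 0]])
    fix n :: nat assume "n > 0"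
    then have n: "real n > 0" by simp
    let ?x = "K * real n powr -1" and ?r = "K * real n powr (1 - \<delta>)" and ?v = "K * real n powr (D - \<delta>)"
    have pw: "(real n powr e) ^ k = real n powr (e * k)" for e k
      using n by (simp add: powr_powr flip: powr_realpow)
    have "real n powr (1 - \<delta>) * real n powr -1 = real n powr (- \<delta>)"
      by (simp only: powr_add[symmetric]) simp
    then have "?r * ?x = K\<^sup>2 * real n powr (- \<delta>)"
      by (metis mult.assoc mult.left_commute power2_eq_square)
    then have 1: "f1 n = 2 * ?x * (1 + ?r * ?x) ^ D" by (simp add: f1_def)
    have "?r\<^sup>2 * ?x = K ^ 3 * real n powr (1 - 2 * \<delta>)"
    proof -
      have "?r\<^sup>2 * ?x = K ^ 3 * (real n powr ((1 - \<delta>) * 2) * real n powr -1)"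
        by (simp only: power_mult_distrib pw) (simp add: power3_eq_cube power2_eq_square)
      also have "\<dots> = K ^ 3 * real n powr (1 - 2 * \<delta>)"
        unfolding powr_add[symmetric] by (simp add: algebra_simps)
      finally show ?thesis .
    qed
    moreover have "?x\<^sup>2 = K\<^sup>2 * (real n powr (- 2 / D)) ^ D"
      unfolding power_mult_distrib pw using Dr by simp
    ultimately have 2: "f2 n = ?x\<^sup>2 * (1 + ?r\<^sup>2 * ?x) ^ D"
      by (simp add: f2_def powr_diff power_mult_distrib[symmetric] mult.assoc)
        (simp add: powr_minus_divide algebra_simps)
    have 3: "f3 n = ?r ^ D * ?v * ?x ^ (D + 1)"
    proof -
      have "?r ^ D * ?v * ?x ^ (D + 1) = K ^ (2 * D + 2) *
          (real n powr ((1 - \<delta>) * D) * real n powr (D - \<delta>) * real n powr (- 1 * real (D + 1)))"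
        by (simp only: power_mult_distrib pw) (simp add: power_add mult_2)
      also have "\<dots> = f3 n"
        by (simp add: f3_def powr_add[symmetric] algebra_simps)
      finally show ?thesis by simp
    qed
    show "f1 n + f2 n + f3 n = pair_excess D ?x ?r ?v"
      unfolding pair_excess_def 1 2 3 by simp
  qed
qed

text \<open>The left-hand side is the order of \<open>1 / \<mu>\<close>. Its exponent is zero
  exactly at \<open>\<delta> = (2 D - 2) / (2 D + 1)\<close>.\<close>

lemma inverse_mean_eq_powr:
  fixes n D :: nat and K \<delta> :: real
  assumes "n > 0"
  shows "(K * real n powr (1 - \<delta>)) ^ (2 * D) * (K * real n powr (D - \<delta>)) * (K * real n powr -1) ^ (D + 2)
    = K ^ (3 * D + 3) * real n powr (2 * real D - 2 - (2 * real D + 1) * \<delta>)"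
proof -
  have pw: "(real n powr e) ^ k = real n powr (e * k)" for e k
    using assms by (simp add: powr_powr flip: powr_realpow)
  have "(K * real n powr (1 - \<delta>)) ^ (2 * D) * (K * real n powr (D - \<delta>)) * (K * real n powr -1) ^ (D + 2)
      = K ^ (3 * D + 3) *
        (real n powr ((1 - \<delta>) * real (2 * D)) * real n powr (D - \<delta>) * real n powr (- 1 * real (D + 2)))"
    by (simp only: power_mult_distrib pw) (simp add: power_add eval_nat_numeral power_mult)
  also have "\<dots> = K ^ (3 * D + 3) * real n powr (2 * real D - 2 - (2 * real D + 1) * \<delta>)"
    by (simp add: powr_add[symmetric] algebra_simps)
  finally show ?thesis .
qed

lemma exact_recovery_prob_nonneg: "0 \<le> exact_recovery_prob d n p"
proof -
  obtain A where "A \<in> estimators d n" using estimators_nonempty by blast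
  then have "measure_pmf.prob (random_hypergraph d n p) {H. A (Proj n H) = H} \<le> exact_recovery_prob d n p"
    unfolding exact_recovery_prob_def by (intro Max_ge) (auto simp: finite_estimators)
  then show ?thesis by (meson measure_nonneg order_trans)
qed

text \<open>\<open>K\<close> dominates the constants of the three separate estimates. The one for
  \<open>r\<close> combines \<open>r \<le> 1 + 1 / (p * M)\<close> with
  \<open>M = m choose (D - 1) \<ge> (m / (D - 1)) ^ (D - 1)\<close>.\<close>

lemma frame_parameters_bound:
  fixes n D :: nat and c \<delta> p :: real
  defines "m \<equiv> n div (D + 3)"
  defines "r \<equiv> 1 / (1 - (1 - p) ^ (m choose (D - 1)))"
  defines "K \<equiv> 1 + (2 * (real D + 3)) + 2 / c + 2 / c * (2 * (real D + 3) * real D) ^ (D - 1)"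
  assumes D: "D \<ge> 2" and c: "c > 0" and \<delta>: "\<delta> < 1"
    and n: "n \<ge> 2 * (D + 3)" "m \<ge> Suc D" and p: "p < 1" "p \<ge> c / 2 * real n powr (\<delta> - D)"
  shows "1 / real m \<le> K * real n powr -1" "r \<le> K * real n powr (1 - \<delta>)"
    "1 / p \<le> K * real n powr (D - \<delta>)" "0 < r" "0 < p"
proof -
  define k where "k = 2 * (real D + 3)"
  have n0: "real n > 0" "real n \<ge> 1" using n by auto
  have k0: "k > 0" by (simp add: k_def)
  have m0: "real m > 0" using n by simp
  \<comment> \<open>The factor 2 in \<open>k\<close> absorbs the rounding in
    \<open>n div (D + 3)\<close>, through \<open>m + 1 \<le> 2 * m\<close>.\<close>
  have mn: "real m \<ge> real n / k"
  proof -
    have "n < (D + 3) * (m + 1)"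
      unfolding m_def using dividend_less_times_div[of "D + 3" n] by (simp add: algebra_simps)
    then have "real n < real ((D + 3) * (m + 1))" by (simp only: of_nat_less_iff)
    also have "\<dots> = (real D + 3) * (real m + 1)" by (simp add: algebra_simps)
    also have "\<dots> \<le> (real D + 3) * (2 * real m)" using n(2) by (intro mult_left_mono) auto
    also have "\<dots> = k * real m" by (simp add: k_def)
    finally show ?thesis using k0 by (simp add: field_simps)
  qed
  have K: "k \<le> K" "2 / c \<le> K" "1 + 2 / c * (k * D) ^ (D - 1) \<le> K"
    using c by (simp_all add: K_def k_def)
  have npos: "real n powr e > 0" for e using n0 by simp
  show p0: "0 < p" using p(2) c npos[of "\<delta> - D"] by (meson half_gt_zero less_le_trans mult_pos_pos)
  have "1 / real m \<le> 1 / (real n / k)" using mn n0 k0 m0 by (intro divide_left_mono) auto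
  also have "\<dots> = k * real n powr -1" using n0 by (simp add: powr_minus_divide)
  also have "\<dots> \<le> K * real n powr -1" using K by (intro mult_right_mono) auto
  finally show "1 / real m \<le> K * real n powr -1" .
  have "1 / p \<le> 1 / (c / 2 * real n powr (\<delta> - D))"
    using p p0 c npos[of "\<delta> - D"] by (intro divide_left_mono mult_pos_pos) auto
  also have "\<dots> = 2 / c * real n powr (D - \<delta>)"
    using powr_minus_divide[of "real n" "\<delta> - D"] by simp
  finally have p_inv: "1 / p \<le> 2 / c * real n powr (D - \<delta>)" .
  also have "\<dots> \<le> K * real n powr (D - \<delta>)" using K by (intro mult_right_mono) auto
  finally show "1 / p \<le> K * real n powr (D - \<delta>)" .
  define M where "M = m choose (D - 1)"
  have M: "M > 0" using n by (simp add: M_def)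
  have "(real n / (k * D)) ^ (D - 1) \<le> (real m / real (D - 1)) ^ (D - 1)"
  proof (rule power_mono)
    have "real n / (k * D) = (real n / k) / D" by simp
    also have "\<dots> \<le> real m / D" using mn by (intro divide_right_mono) auto
    also have "\<dots> \<le> real m / real (D - 1)" using D by (intro divide_left_mono) auto
    finally show "real n / (k * D) \<le> real m / real (D - 1)" .
  qed (use k0 in simp)
  also have "\<dots> \<le> real M"
    unfolding M_def using n by (intro binomial_ge_n_over_k_pow_k) simp
  finally have "1 / real M \<le> 1 / (real n / (k * D)) ^ (D - 1)"
    using M n0 k0 D by (intro divide_left_mono mult_pos_pos) auto
  also have "\<dots> = (k * D) ^ (D - 1) * real n powr (- real (D - 1))"
    using n0 by (simp add: power_divide powr_minus_divide powr_realpow)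
  finally have M_inv: "1 / real M \<le> (k * D) ^ (D - 1) * real n powr (- real (D - 1))" .
  have "r \<le> 1 + 1 / (p * M)"
    using inverse_one_minus_power_le[of p M] p p0 M by (simp add: r_def M_def)
  also have "1 / (p * M) = 1 / p * (1 / M)" by simp
  also have "\<dots> \<le> (2 / c * real n powr (D - \<delta>)) * ((k * D) ^ (D - 1) * real n powr (- real (D - 1)))"
    using p_inv M_inv p0 c by (intro mult_mono) auto
  also have "\<dots> = 2 / c * (k * D) ^ (D - 1) * (real n powr (D - \<delta>) * real n powr (- real (D - 1)))"
    by simp
  also have "real n powr (D - \<delta>) * real n powr (- real (D - 1)) = real n powr (1 - \<delta>)"
    using D by (simp add: powr_add[symmetric] of_nat_diff)
  \<comment> \<open>The summand 1 is absorbed because \<open>n powr (1 - \<delta>) \<ge> 1\<close>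
    for \<open>\<delta> < 1\<close>.\<close>
  also have "1 + 2 / c * (k * D) ^ (D - 1) * real n powr (1 - \<delta>)
      \<le> (1 + 2 / c * (k * D) ^ (D - 1)) * real n powr (1 - \<delta>)"
    using ge_one_powr_ge_zero[of "real n" "1 - \<delta>"] n0 \<delta> by (simp add: algebra_simps)
  also have "\<dots> \<le> K * real n powr (1 - \<delta>)" using K by (intro mult_right_mono) auto
  finally show "r \<le> K * real n powr (1 - \<delta>)" by simp
  have "(1 - p) ^ M < 1" using M p p0 by (intro power_less_one_iff[THEN iffD2]) auto
  then show "0 < r" by (simp add: r_def M_def)
qed

text \<open>One bound serves both regimes: \<open>p\<close> and \<open>\<eta>\<close> vanish in
  either case, while the power of \<open>n\<close> is constant at the threshold and tends to 0 above
  it.\<close>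

lemma eventually_recovery_failure_ge:
  fixes D :: nat and c \<delta> :: real and \<epsilon> p :: "nat \<Rightarrow> real"
  assumes D: "D \<ge> 2" and c: "c > 0" and \<delta>: "\<delta> < 1" "\<delta> \<ge> (2 * real D - 2) / (2 * real D + 1)"
    and \<epsilon>: "\<epsilon> \<in> o(\<lambda>_. 1)"
    and p: "\<forall>\<^sub>F n in sequentially. p n = (c + \<epsilon> n) * real n powr (\<delta> - D)"
  obtains K \<eta> where "K > 0" "(p \<longlongrightarrow> 0) sequentially" "(\<eta> \<longlongrightarrow> 0) sequentially"
    "\<forall>\<^sub>F n in sequentially. (1 - p n)\<^sup>2 /
        (1 + \<eta> n + K * real n powr (2 * real D - 2 - (2 * real D + 1) * \<delta>))
      \<le> 1 - exact_recovery_prob (Suc D) n (p n)"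
proof -
  define L where "L = 1 + (2 * (real D + 3)) + 2 / c + 2 / c * (2 * (real D + 3) * real D) ^ (D - 1)"
  define \<eta> where "\<eta> n = pair_excess D (L * real n powr -1) (L * real n powr (1 - \<delta>)) (L * real n powr (D - \<delta>))"
    for n :: nat
  have L0: "L > 0" using c by (simp add: L_def add_pos_nonneg)
  have \<eta>0: "\<eta> n \<ge> 0" for n using L0 by (simp add: \<eta>_def pair_excess_def)
  have \<epsilon>0: "(\<epsilon> \<longlongrightarrow> 0) sequentially" using smalloD_tendsto[OF \<epsilon>] by simp
  have "((\<lambda>n. (c + \<epsilon> n) * real n powr (\<delta> - D)) \<longlongrightarrow> (c + 0) * 0) sequentially"
    using D \<delta> by (intro tendsto_intros \<epsilon>0 powr_tendsto_0) auto
  then have p0: "(p \<longlongrightarrow> 0) sequentially"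
    by (simp add: tendsto_cong[OF p])
  have "\<forall>\<^sub>F n in sequentially. p n < 1" using p0 by (rule order_tendstoD) simp
  moreover have "\<forall>\<^sub>F n in sequentially. \<epsilon> n > - c / 2" using \<epsilon>0 c by (intro order_tendstoD) auto
  \<comment> \<open>From this point on the block length is at least \<open>Suc D\<close>, the
    uniformity of the hypergraph.\<close>
  moreover have "\<forall>\<^sub>F n in sequentially. n \<ge> (D + 3) * Suc D" by (rule eventually_ge_at_top)
  ultimately have "\<forall>\<^sub>F n in sequentially. (1 - p n)\<^sup>2 /
        (1 + \<eta> n + 2 * L ^ (3 * D + 3) * real n powr (2 * real D - 2 - (2 * real D + 1) * \<delta>))
      \<le> 1 - exact_recovery_prob (Suc D) n (p n)"
    using p
  proof eventually_elim
    case (elim n)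
    let ?m = "n div (D + 3)"
    define r where "r = 1 / (1 - (1 - p n) ^ (?m choose (D - 1)))"
    let ?x = "L * real n powr -1" and ?R = "L * real n powr (1 - \<delta>)" and ?v = "L * real n powr (D - \<delta>)"
    have m: "?m \<ge> Suc D" using elim(3) by (simp add: less_eq_div_iff_mult_less_eq mult.commute)
    have "2 * (D + 3) \<le> (D + 3) * Suc D"
      using mult_le_mono2[of 2 "Suc D" "D + 3"] D by simp
    then have n: "n \<ge> 2 * (D + 3)" using elim(3) by linarith
    have "p n \<ge> c / 2 * real n powr (\<delta> - D)"
      unfolding elim(4) using elim(2) by (intro mult_right_mono) auto
    note b = frame_parameters_bound[OF D c \<delta>(1) n m elim(1) this, folded L_def r_def]
    have "r ^ (2 * D) * (1 / p n) * (1 / real ?m) ^ (D + 2) \<le> ?R ^ (2 * D) * ?v * ?x ^ (D + 2)"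
      using b L0 by (intro mult_mono power_mono mult_nonneg_nonneg zero_le_power) auto
    also have "\<dots> = L ^ (3 * D + 3) * real n powr (2 * real D - 2 - (2 * real D + 1) * \<delta>)"
      using n by (intro inverse_mean_eq_powr) simp
    finally have \<mu>: "r ^ (2 * D) * (1 / p n) * (1 / real ?m) ^ (D + 2) \<le> \<dots>" .
    have pe: "pair_excess D (1 / ?m) r (1 / p n) \<le> \<eta> n"
      unfolding \<eta>_def using b by (intro pair_excess_mono) auto
    have pe0: "pair_excess D (1 / ?m) r (1 / p n) \<ge> 0"
      using b by (simp add: pair_excess_def)
    have mu0: "r ^ (2 * D) * (1 / p n) * (1 / real ?m) ^ (D + 2) \<ge> 0"
      using b by (intro mult_nonneg_nonneg zero_le_power) auto
    have "(1 - p n)\<^sup>2 /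
        (1 + \<eta> n + 2 * L ^ (3 * D + 3) * real n powr (2 * real D - 2 - (2 * real D + 1) * \<delta>))
      \<le> (1 - p n)\<^sup>2 / (1 + pair_excess D (1 / ?m) r (1 / p n)
      + 2 * (r ^ (2 * D) * (1 / p n) * (1 / real ?m) ^ (D + 2)))"
    proof (rule divide_left_mono)
      show "1 + pair_excess D (1 / ?m) r (1 / p n) + 2 * (r ^ (2 * D) * (1 / p n) * (1 / real ?m) ^ (D + 2))
        \<le> 1 + \<eta> n + 2 * L ^ (3 * D + 3) * real n powr (2 * real D - 2 - (2 * real D + 1) * \<delta>)"
        using \<mu> pe by linarith
      show "0 < (1 + \<eta> n + 2 * L ^ (3 * D + 3) * real n powr (2 * real D - 2 - (2 * real D + 1) * \<delta>)) *
        (1 + pair_excess D (1 / ?m) r (1 / p n) + 2 * (r ^ (2 * D) * (1 / p n) * (1 / real ?m) ^ (D + 2)))"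
        using \<eta>0[of n] L0 pe0 mu0 by (intro mult_pos_pos add_pos_nonneg) auto
    qed simp
    also have "\<dots> \<le> 1 - exact_recovery_prob (Suc D) n (p n)"
      using recovery_failure_explicit[OF D m b(5) elim(1)] by (simp only: r_def)
    finally show ?case .
  qed
  then show thesis
    using L0 p0 \<eta>0 pair_excess_tendsto_0[OF D \<delta>(2), of L]
    by (intro that[of "2 * L ^ (3 * D + 3)" \<eta>]) (auto simp: \<eta>_def[abs_def])
qed

theorem theorem31:
  fixes d :: nat and c \<delta> :: real and \<epsilon> p :: "nat \<Rightarrow> real"
  assumes "d \<ge> 3" and "c > 0" and "\<delta> < 1"
    and "\<epsilon> \<in> o(\<lambda>_. 1)"
    and "\<forall>\<^sub>F n in sequentially. p n = (c + \<epsilon> n) * real n powr (- real d + 1 + \<delta>)"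
  shows "(\<delta> = (2 * real d - 4) / (2 * real d - 1) \<longrightarrow>
            (\<lambda>n. 1 - exact_recovery_prob d n (p n)) \<in> \<Omega>(\<lambda>_. 1)) \<and>
         (\<delta> > (2 * real d - 4) / (2 * real d - 1) \<longrightarrow>
            (\<lambda>n. exact_recovery_prob d n (p n)) \<in> o(\<lambda>_. 1))"
proof -
  define D where "D = d - 1"
  have d: "d = Suc D" and D: "D \<ge> 2" using assms(1) by (auto simp: D_def)
  have thr: "(2 * real d - 4) / (2 * real d - 1) = (2 * real D - 2) / (2 * real D + 1)"
    by (simp add: d)
  have p: "\<forall>\<^sub>F n in sequentially. p n = (c + \<epsilon> n) * real n powr (\<delta> - D)"
    using assms(5) by (simp add: d)
  define e where "e = 2 * real D - 2 - (2 * real D + 1) * \<delta>"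
  show ?thesis
  proof (cases "\<delta> \<ge> (2 * real D - 2) / (2 * real D + 1)")
    case False
    then show ?thesis unfolding thr by simp
  next
    case True
    obtain K \<eta> where K: "K > 0" and lim: "(p \<longlongrightarrow> 0) sequentially" "(\<eta> \<longlongrightarrow> 0) sequentially"
      and fail: "\<forall>\<^sub>F n in sequentially. (1 - p n)\<^sup>2 / (1 + \<eta> n + K * real n powr e)
        \<le> 1 - exact_recovery_prob (Suc D) n (p n)"
      by (rule eventually_recovery_failure_ge[OF D assms(2,3) True assms(4) p, folded e_def])
    show ?thesis
    proof (intro conjI impI)
      assume "\<delta> = (2 * real d - 4) / (2 * real d - 1)"
      then have \<delta>: "\<delta> = (2 * real D - 2) / (2 * real D + 1)" by (simp only: thr)
      then have e: "e = 0" by (simp add: e_def)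
      have "((\<lambda>n. (1 - p n)\<^sup>2 / (1 + \<eta> n + K)) \<longlongrightarrow> (1 - 0)\<^sup>2 / (1 + 0 + K)) sequentially"
        using K by (intro tendsto_intros lim) simp
      \<comment> \<open>The constant is half of the limit \<open>1 / (1 + K)\<close>.\<close>
      then have "\<forall>\<^sub>F n in sequentially. (1 - p n)\<^sup>2 / (1 + \<eta> n + K) > 1 / (2 + 2 * K)"
        by (rule order_tendstoD) (use K in \<open>simp add: field_simps\<close>)
      \<comment> \<open>The condition \<open>n > 0\<close> is needed to replace
        \<open>real n powr 0\<close> by 1, because \<open>0 powr 0 = 0\<close>.\<close>
      then have "\<forall>\<^sub>F n in sequentially. 1 / (2 + 2 * K) * norm (1 :: real) \<le> norm (1 - exact_recovery_prob d n (p n))"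
        using fail eventually_gt_at_top[of 0]
      proof eventually_elim
        case (elim n)
        then have "1 / (2 + 2 * K) \<le> 1 - exact_recovery_prob d n (p n)" by (simp add: e d)
        then show ?case by simp
      qed
      then show "(\<lambda>n. 1 - exact_recovery_prob d n (p n)) \<in> \<Omega>(\<lambda>_. 1)"
        using K by (intro landau_omega.bigI[of "1 / (2 + 2 * K)"]) auto
    next
      assume "\<delta> > (2 * real d - 4) / (2 * real d - 1)"
      then have \<delta>: "\<delta> > (2 * real D - 2) / (2 * real D + 1)" by (simp only: thr)
      then have e: "e < 0" using D by (simp add: e_def field_simps)
      \<comment> \<open>For \<open>e < 0\<close> the denominator tends to 1, so the upper bound on
        the recovery probability tends to 0.\<close>
      have "((\<lambda>n. 1 - (1 - p n)\<^sup>2 / (1 + \<eta> n + K * real n powr e)) \<longlongrightarrow>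
          1 - (1 - 0)\<^sup>2 / (1 + 0 + K * 0)) sequentially"
        using e by (intro tendsto_intros lim powr_tendsto_0) auto
      then have upper: "((\<lambda>n. 1 - (1 - p n)\<^sup>2 / (1 + \<eta> n + K * real n powr e)) \<longlongrightarrow> 0) sequentially"
        by simp
      have le: "\<forall>\<^sub>F n in sequentially. exact_recovery_prob d n (p n)
          \<le> 1 - (1 - p n)\<^sup>2 / (1 + \<eta> n + K * real n powr e)"
        using fail by eventually_elim (simp add: d)
      have "((\<lambda>n. exact_recovery_prob d n (p n)) \<longlongrightarrow> 0) sequentially"
        by (rule tendsto_sandwich[OF _ le tendsto_const upper])
          (simp add: exact_recovery_prob_nonneg)
      then show "(\<lambda>n. exact_recovery_prob d n (p n)) \<in> o(\<lambda>_. 1)"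
        by (intro smalloI_tendsto) auto
    qed
  qed
qed

end
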